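(* Let $(m,n,k)$ be any triple of integers such that $k^2-4mn>0$ is not a perfect square, and let $\Pi(m,n,k)=[a_1,a_2,\dots,a_p]$. Define $$t_{odd}:=\sum_{1\le i\le p,\ i\ \mathrm{odd}} a_i,\qquad t_{even}:=\sum_{1\le i\le p,\ i\ \mathrm{even}} a_i,\qquad t:=\sum_{i=1}^{p} a_i .$$ The class $C(m,n,k)$ has $t$ points in $H^0$ and $t$ points in $H^0_R$, and it has $t_{odd}$ points in every domain of $G_A$ and $G_{\bar A}$ and $t_{even}$ points in every domain of $G_B$ and $G_{\bar B}$, or vice versa (i.e. $t_{even}$ points in every domain of $G_A$ and $G_{\bar A}$ and $t_{odd}$ points in every domain of $G_B$ and $G_{\bar B}$). Moreover $t_{odd}=t_{even}=t/2$ if $\Gamma(m,n,k)$ is either odd, or even and palindromic, i.e. if the class $C(m,n,k)$ is supersymmetric, antisymmetric, or $(m+n)$-symmetric.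
   Context: The triple $\mathbf f=(m,n,k)$ denotes the binary quadratic form $f(x,y)=mx^2+ny^2+kxy$ of discriminant $\Delta=k^2-4mn$. For integer triples, the class $C(m,n,k)$ is the orbit of $\mathbf f$ under the action of $\mathrm{SL}(2,\mathbb{Z})$ by linear changes of the variables $(x,y)$; its elements are called its points. The action of the generators is $A(m,n,k)=(m,m+n+k,k+2m)$ (from $f(x+y,y)$) and $B(m,n,k)=(m+n+k,n,k+2n)$ (from $f(x,x+y)$). $\mathcal T^+$ is the monoid generated by $A$ and $B$ (including the identity), $\mathcal T^-$ the monoid generated by $A^{-1}$ and $B^{-1}$. Domains in the space of real forms of the given discriminant $\Delta>0$: $H^0=\{m>0,\ n<0\}$; $H^0_R=\{m<0,\ n>0\}$; $H_A=\{m,n>0,\ k>0,\ m+n<k\}$; $H_{\bar A}=\{m,n>0,\ k<0,\ m+n<-k\}$; $H_B=\{m,n<0,\ k<0,\ m+n>k\}$; $H_{\bar B}=\{m,n<0,\ k>0,\ m+n>-k\}$. The domains of $G_A$ are the images $T(H_A)$, $T\in\mathcal T^+$; the domains of $G_B$ are $T(H_B)$, $T\in\mathcal T^+$; the domains of $G_{\bar A}$ are $T(H_{\bar A})$, $T\in\mathcal T^-$; the domains of $G_{\bar B}$ are $T(H_{\bar B})$, $T\in\mathcal T^-$. For $\Delta>0$ not a perfect square, put $\xi^{+}(\mathbf f)=\frac{-k+\sqrt{\Delta}}{2m}$; its (regular) continued fraction is eventually periodic (for negative $\xi$, it is minus the continued fraction of $|\xi|$). $\Gamma(m,n,k)=[a_1,\dots,a_P]$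 denotes its period (minimal repeating block of positive integers), defined up to cyclic permutation. If $P$ is odd, $\Pi(m,n,k)=\Gamma^2=[a_1,\dots,a_P,a_{P+1},\dots,a_p]$ with $p=2P$ and $a_{P+i}=a_i$ for $i=1,\dots,P$; if $P$ is even, $\Pi(m,n,k)=\Gamma(m,n,k)$ and $p=P$. A period is odd/even according to its length; it is palindromic if some cyclic permutation of it equals the same sequence written backwards. Conjugate: $\overline{\mathbf f}=(m,n,-k)$; adjoint: $\mathbf f^*=(-n,-m,k)$; antipodal: $\overline{\mathbf f}^*=(-n,-m,-k)$. A class is supersymmetric if invariant under all three involutions; antisymmetric if invariant under the antipodal one only; $(m+n)$-symmetric if invariant under the adjoint one only. *)

theory Defs
  imports Complex_Main "HOL-Computational_Algebra.Nth_Powers"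
begin

(* The triple (m, n, k) stands for the form m x^2 + n y^2 + k x y: the coefficient of xy comes last.
   The type of the coefficients is int for the points of a class, real for the domains. *)
type_synonym 'a bqf = "'a \<times> 'a \<times> 'a"

fun qf_eval :: "'a::comm_ring_1 bqf \<Rightarrow> 'a \<Rightarrow> 'a \<Rightarrow> 'a" where
  "qf_eval (m, n, k) x y = m * x^2 + n * y^2 + k * x * y"

fun qf_disc :: "'a::comm_ring_1 bqf \<Rightarrow> 'a" where
  "qf_disc (m, n, k) = k^2 - 4 * m * n"

(* The coefficients of f(a x + b y, c x + d y), see qf_eval_subst. *)
fun qf_subst :: "'a::comm_ring_1 \<Rightarrow> 'a \<Rightarrow> 'a \<Rightarrow> 'a \<Rightarrow> 'a bqf \<Rightarrow> 'a bqf" where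
  "qf_subst a b c d (m, n, k) =
     (m * a^2 + n * c^2 + k * a * c,
      m * b^2 + n * d^2 + k * b * d,
      2 * m * a * b + 2 * n * c * d + k * (a * d + b * c))"

lemma qf_eval_subst:
  "qf_eval (qf_subst a b c d f) x y = qf_eval f (a * x + b * y) (c * x + d * y)"
  by (cases f) (simp add: algebra_simps power2_eq_square)

definition qf_class :: "int bqf \<Rightarrow> int bqf set" where
  "qf_class f = {qf_subst a b c d f | a b c d. a * d - b * c = 1}"

fun opA :: "'a::comm_ring_1 bqf \<Rightarrow> 'a bqf" where
  "opA (m, n, k) = (m, m + n + k, k + 2 * m)"

fun opB :: "'a::comm_ring_1 bqf \<Rightarrow> 'a bqf" where
  "opB (m, n, k) = (m + n + k, n, k + 2 * n)"

lemma opA_subst: "opA = qf_subst 1 1 0 1"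
  by (rule ext, case_tac x) (simp add: algebra_simps)

lemma opB_subst: "opB = qf_subst 1 0 1 1"
  by (rule ext, case_tac x) (simp add: algebra_simps)

lemma bij_opA: "bij (opA :: 'a::comm_ring_1 bqf \<Rightarrow> 'a bqf)"
  by (rule bij_betw_byWitness[where f' = "qf_subst 1 (-1) 0 1"]) (auto simp: algebra_simps)

lemma bij_opB: "bij (opB :: 'a::comm_ring_1 bqf \<Rightarrow> 'a bqf)"
  by (rule bij_betw_byWitness[where f' = "qf_subst 1 0 (-1) 1"]) (auto simp: algebra_simps)

inductive_set T_plus :: "(real bqf \<Rightarrow> real bqf) set" where
  T_plus_id: "id \<in> T_plus"
| T_plus_A: "T \<in> T_plus \<Longrightarrow> opA \<circ> T \<in> T_plus"
| T_plus_B: "T \<in> T_plus \<Longrightarrow> opB \<circ> T \<in> T_plus"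

inductive_set T_minus :: "(real bqf \<Rightarrow> real bqf) set" where
  T_minus_id: "id \<in> T_minus"
| T_minus_A: "T \<in> T_minus \<Longrightarrow> inv opA \<circ> T \<in> T_minus"
| T_minus_B: "T \<in> T_minus \<Longrightarrow> inv opB \<circ> T \<in> T_minus"

definition dom_H0 :: "real \<Rightarrow> real bqf set" where
  "dom_H0 D = {(m, n, k). qf_disc (m, n, k) = D \<and> m > 0 \<and> n < 0}"

definition dom_H0R :: "real \<Rightarrow> real bqf set" where
  "dom_H0R D = {(m, n, k). qf_disc (m, n, k) = D \<and> m < 0 \<and> n > 0}"

definition dom_HA :: "real \<Rightarrow> real bqf set" where
  "dom_HA D = {(m, n, k). qf_disc (m, n, k) = D \<and> m > 0 \<and> n > 0 \<and> k > 0 \<and> m + n < k}"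

definition dom_HAbar :: "real \<Rightarrow> real bqf set" where
  "dom_HAbar D = {(m, n, k). qf_disc (m, n, k) = D \<and> m > 0 \<and> n > 0 \<and> k < 0 \<and> m + n < - k}"

definition dom_HB :: "real \<Rightarrow> real bqf set" where
  "dom_HB D = {(m, n, k). qf_disc (m, n, k) = D \<and> m < 0 \<and> n < 0 \<and> k < 0 \<and> m + n > k}"

definition dom_HBbar :: "real \<Rightarrow> real bqf set" where
  "dom_HBbar D = {(m, n, k). qf_disc (m, n, k) = D \<and> m < 0 \<and> n < 0 \<and> k > 0 \<and> m + n > - k}"

definition doms_GA :: "real \<Rightarrow> real bqf set set" where
  "doms_GA D = {T ` dom_HA D | T. T \<in> T_plus}"

definition doms_GB :: "real \<Rightarrow> real bqf set set" where
  "doms_GB D = {T ` dom_HB D | T. T \<in> T_plus}"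

definition doms_GAbar :: "real \<Rightarrow> real bqf set set" where
  "doms_GAbar D = {T ` dom_HAbar D | T. T \<in> T_minus}"

definition doms_GBbar :: "real \<Rightarrow> real bqf set set" where
  "doms_GBbar D = {T ` dom_HBbar D | T. T \<in> T_minus}"

fun real_qf :: "int bqf \<Rightarrow> real bqf" where
  "real_qf (m, n, k) = (real_of_int m, real_of_int n, real_of_int k)"

definition points_in :: "int bqf set \<Rightarrow> real bqf set \<Rightarrow> int bqf set" where
  "points_in C H = {f \<in> C. real_qf f \<in> H}"

fun xi_plus :: "int bqf \<Rightarrow> real" where
  "xi_plus (m, n, k) =
     (- real_of_int k + sqrt (real_of_int (qf_disc (m, n, k)))) / (2 * real_of_int m)"

(* The i-th partial quotient of the regular continued fraction of an irrational x. *)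
definition cf_quot :: "real \<Rightarrow> nat \<Rightarrow> int" where
  "cf_quot x i = \<lfloor>((\<lambda>y. 1 / frac y) ^^ i) x\<rfloor>"

definition cf_repeats :: "real \<Rightarrow> nat list \<Rightarrow> bool" where
  "cf_repeats x l \<longleftrightarrow> l \<noteq> [] \<and> 0 \<notin> set l \<and>
     (\<exists>N. \<forall>i. cf_quot x (N + i) = int (l ! (i mod length l)))"

(* The period is determined only up to rotation, hence a relation: the starting index N in
   cf_repeats is arbitrary.  A negative number has minus the continued fraction of its absolute
   value, hence the absolute value. *)
definition is_period :: "int bqf \<Rightarrow> nat list \<Rightarrow> bool" where
  "is_period f l \<longleftrightarrow> cf_repeats \<bar>xi_plus f\<bar> l \<and>
     (\<forall>l'. cf_repeats \<bar>xi_plus f\<bar> l' \<longrightarrow> length l \<le> length l')"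

definition even_period :: "nat list \<Rightarrow> nat list" where
  "even_period l = (if odd (length l) then l @ l else l)"

(* Some rotation of l is a palindrome.  This is stronger than: some rotation of l equals rev l,
   which holds for every list of length two. *)
definition palindromic :: "nat list \<Rightarrow> bool" where
  "palindromic l \<longleftrightarrow> (\<exists>r. rev (rotate r l) = rotate r l)"

fun qf_conj :: "int bqf \<Rightarrow> int bqf" where
  "qf_conj (m, n, k) = (m, n, - k)"

fun qf_adj :: "int bqf \<Rightarrow> int bqf" where
  "qf_adj (m, n, k) = (- n, - m, k)"

fun qf_anti :: "int bqf \<Rightarrow> int bqf" where
  "qf_anti (m, n, k) = (- n, - m, - k)"

definition supersymmetric :: "int bqf set \<Rightarrow> bool" where
  "supersymmetric C \<longleftrightarrow> qf_conj ` C = C \<and> qf_adj ` C = C \<and> qf_anti ` C = C"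

definition antisymmetric :: "int bqf set \<Rightarrow> bool" where
  "antisymmetric C \<longleftrightarrow> qf_conj ` C \<noteq> C \<and> qf_adj ` C \<noteq> C \<and> qf_anti ` C = C"

definition mn_symmetric :: "int bqf set \<Rightarrow> bool" where
  "mn_symmetric C \<longleftrightarrow> qf_conj ` C \<noteq> C \<and> qf_adj ` C = C \<and> qf_anti ` C \<noteq> C"

end

theory Submission
  imports Defs
begin

text \<open>
The proof follows one map. Let \<open>f\<close> be a form with \<open>m > 0 > n\<close>, and let \<open>step f\<close> be whichever of
\<open>opA f\<close>, \<open>opB f\<close> again satisfies these two inequalities: the sign of \<open>f(1,1)\<close> decides, and exactly one
of them does. Since \<open>step\<close> is injective and there are finitely many such forms of a given
discriminant, the points of a class in \<open>H0\<close> are permuted. On the first root \<open>\<xi> = xi_plus f\<close> the map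
acts as the slow (subtractive) continued fraction algorithm \<open>slow\<close>: \<open>\<xi> \<mapsto> \<xi> - 1\<close> if \<open>\<xi> > 1\<close> and
\<open>\<xi> \<mapsto> \<xi> / (1 - \<xi>)\<close> if \<open>\<xi> < 1\<close>. Recording which branch is taken, one reads the partial quotients
\<open>a\<^sub>0, a\<^sub>1, a\<^sub>2, \<dots>\<close> as the lengths of the alternating runs of letters (\<open>itin_cf_prefix\<close>).

\<^bold>\<open>The class is one cycle, of length t.\<close> Extended to negative irrationals by \<open>x \<mapsto> x + 1\<close>, the
slow map has the property that \<open>x\<close>, \<open>x - 1\<close> and \<open>- 1 / x\<close> have a common tail, so all first roots of
a class share one (\<open>merge_subst\<close>); as roots determine forms, the points of the class in \<open>H0\<close> form a
single cycle (\<open>class_merge\<close>). The cycle passes through the number \<open>y\<close> whose continued fraction is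
purely periodic with the given period. One turn of the cycle spells the word of \<open>\<Pi>\<close>; its length is
exactly \<open>t\<close> and not a proper divisor of it, because a return to \<open>y\<close> happens at a change of letter,
hence after an even number of complete runs, and because \<open>\<Gamma>\<close> is minimal (\<open>slow_cycle_minimal\<close>).

\<^bold>\<open>Other domains.\<close> \<open>H\<^sub>A\<close> is the image under \<open>opA\<close> of those points of \<open>H0\<close> at which the letter is \<open>B\<close>, and
\<open>H\<^sub>B\<close> the image under \<open>opB\<close> of those with letter \<open>A\<close>; for the two conjugate domains the same holds
with the inverses, read at the end of a step instead of at its beginning. All further domains are images of these
under maps preserving the class. So the counts are the numbers of letters of either kind
in the word of \<open>\<Pi>\<close> (\<open>card_letter\<close>). Which letter belongs to the odd positions depends on the parity of
the preperiod and on the sign of \<open>\<xi>\<close>; if necessary the period is rotated by one place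
(\<open>aligned_period\<close>).

\<^bold>\<open>Symmetries.\<close> The antipodal map is \<open>\<xi> \<mapsto> 1 / \<xi>\<close>; it commutes with \<open>slow\<close> and exchanges the letters, so
the class is antipodal iff the cycle is carried to itself by the exchange, iff \<open>\<Gamma>\<close> is odd (\<open>anti_iff\<close>). The
adjoint reverses the cycle and exchanges the letters, so a class is invariant under it iff the
reversed list of run lengths is an even rotation of the original (\<open>adj_iff\<close>), which for a period of
even length is palindromicity in the sense of an axis between two entries (\<open>palindromic_iff\<close>). The
converse direction, like the periodicity of \<open>y\<close>, needs that an eventually periodic itinerary determines its number; this holds
because \<open>slow\<close> is an isometry on one branch and expands strictly on the other
(\<open>itinerary_determines\<close>).
\<close>

section \<open>Run-length words\<close>

text \<open>The word whose run lengths are the entries of the list, beginning with a run of \<open>True\<close>. The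
complement in the recursion lets each later entry start afresh with \<open>True\<close>.\<close>

fun runs :: "nat list \<Rightarrow> bool list" where
  "runs [] = []"
| "runs (a # l) = replicate a True @ map Not (runs l)"

lemma Not_comp_Not [simp]: "Not \<circ> Not = (\<lambda>b. b)"
  by auto

lemma runs_append:
  "runs (l @ l') = runs l @ (if even (length l) then runs l' else map Not (runs l'))"
  by (induction l) auto

lemma runs_rev:
  "runs (rev l) = (if even (length l) then map Not (rev (runs l)) else rev (runs l))"
  by (induction l) (auto simp: runs_append rev_map)

lemma length_runs [simp]: "length (runs l) = sum_list l"
  by (induction l) auto

lemma runs_hd: "l \<noteq> [] \<Longrightarrow> 0 \<notin> set l \<Longrightarrow> runs l \<noteq> [] \<and> hd (runs l)"
  by (cases l; cases "hd l") auto

lemma runs_last: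
  assumes "l \<noteq> []" "0 \<notin> set l" "even (length l)"
  shows "\<not> last (runs l)"
proof -
  have "runs (rev l) \<noteq> []" "hd (runs (rev l))"
    using runs_hd[of "rev l"] assms by auto
  then show ?thesis using assms(3) by (simp add: runs_rev hd_map hd_rev)
qed

text \<open>Two positive lists with the same word agree: maximal runs recover the entries one by one. A zero
entry would fuse the two runs next to it.\<close>

lemma runs_inject:
  assumes "runs l = runs l'" "0 \<notin> set l" "0 \<notin> set l'"
  shows "l = l'"
  using assms
proof (induction l arbitrary: l')
  case Nil
  then show ?case using runs_hd[of l'] by (cases l') auto
next
  case (Cons a l)
  then obtain b l2 where l': "l' = b # l2"
    using runs_hd[of "a # l"] by (cases l') auto
  have run: "takeWhile (\<lambda>x. x) (runs (c # l)) = replicate c True" if "0 \<notin> set l" for c l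
  proof -
    have "runs l = [] \<or> (\<exists>w. runs l = True # w)"
      using that runs_hd[of l] by (cases "l = []"; cases "runs l") auto
    then show ?thesis by (auto simp: takeWhile_append)
  qed
  have "replicate a True = replicate b True"
    using Cons.prems l' run[of l a] run[of l2 b] by (simp del: runs.simps)
  then have ab: "a = b" by (metis length_replicate)
  then have "map Not (map Not (runs l)) = map Not (map Not (runs l2))"
    using Cons.prems l' by simp
  then show ?case using Cons l' ab by simp
qed

lemma count_list_map_Not: "count_list (map Not w) b = count_list w (\<not> b)"
  by (induction w) auto

lemma count_runs:
  "count_list (runs l) b = (\<Sum>i<length l. if even i = b then l ! i else 0)"
proof (induction l arbitrary: b)
  case (Cons a l)
  have "count_list (replicate a True) b = (if b then a else 0)"
    by (induction a) auto
  moreover have "(\<Sum>i<length l. if odd i = b then l ! i else 0)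
      = (\<Sum>i<length l. if even i = (\<not> b) then l ! i else 0)"
    by (rule sum.cong) auto
  ultimately show ?case
    using Cons[of "\<not> b"] by (simp add: count_list_map_Not sum.lessThan_Suc_shift del: sum.lessThan_Suc cong: if_cong)
qed simp

lemma count_runs_total: "count_list (runs l) True + count_list (runs l) False = sum_list l"
proof -
  have "count_list w True + count_list w False = length w" for w
    by (induction w) auto
  then show ?thesis by (metis length_runs)
qed

text \<open>The second copy of a list of odd length is spelled with the letters exchanged, so both letters
occur equally often.\<close>

lemma count_runs_doubled:
  assumes "odd (length l)"
  shows "count_list (runs (l @ l)) b = sum_list l"
  using count_runs_total[of l] assms by (cases b) (auto simp: runs_append count_list_map_Not)

text \<open>Moving the first run of a word with an even number of runs to its end and exchanging the letters
is again the word of a list, namely of the list rotated by one place.\<close>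

lemma count_runs_even_period_rotate1:
  assumes "l \<noteq> []"
  shows "count_list (runs (even_period (rotate1 l))) b = count_list (runs (even_period l)) (\<not> b)"
proof (cases "odd (length l)")
  case True
  have "sum_list (rotate1 l) = sum_list l" by (cases l) auto
  then show ?thesis
    using True count_runs_doubled[of l] count_runs_doubled[of "rotate1 l"]
    by (simp add: even_period_def)
next
  case False
  obtain a l' where l: "l = a # l'" using assms by (cases l) auto
  have c: "count_list (replicate a c) b = (if b = c then a else 0)" for c b
    by (induction a) auto
  show ?thesis
    using False by (cases b) (simp_all add: even_period_def l runs_append count_list_map_Not c)
qed

lemma rotate_rev_rotate: "rotate r (rev (rotate r l)) = rev l"
proof (cases "l = []")
  case False
  have "(length l - r mod length l + r) mod length l = 0"
  proof -
    have "r mod length l < length l" using False by simp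
    then have "length l - r mod length l + r = length l + r div length l * length l"
      using div_mult_mod_eq[of r "length l"] by linarith
    then show ?thesis by simp
  qed
  then have "rotate (length l - r mod length l + r) l = l"
    by (subst rotate_conv_mod) simp
  then show ?thesis by (simp add: rotate_rev rotate_rotate)
qed simp

lemma inj_rotate: "inj (rotate n)"
proof -
  have "inj (rotate1 :: 'a list \<Rightarrow> 'a list)"
  proof (rule injI)
    fix xs ys :: "'a list"
    assume "rotate1 xs = rotate1 ys"
    then show "xs = ys" by (cases xs; cases ys) auto
  qed
  then show ?thesis unfolding rotate_def by (rule inj_fn)
qed

text \<open>If the rotation of \<open>l\<close> by \<open>r\<close> is a palindrome, reversing \<open>l\<close> itself amounts to rotating it by \<open>2 * r\<close>,
whence the even shift.\<close>

lemma palindromic_iff: "palindromic l \<longleftrightarrow> (\<exists>j. even j \<and> rev l = rotate j l)"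
proof
  assume "palindromic l"
  then obtain r where "rev (rotate r l) = rotate r l" by (auto simp: palindromic_def)
  then have "rev l = rotate (r + r) l"
    using rotate_rev_rotate[of r l] by (simp add: rotate_rotate)
  moreover have "even (r + r)" by simp
  ultimately show "\<exists>j. even j \<and> rev l = rotate j l" by blast
next
  assume "\<exists>j. even j \<and> rev l = rotate j l"
  then obtain i where "rev l = rotate (2 * i) l" by (auto elim: evenE)
  then have "rotate i (rev (rotate i l)) = rotate i (rotate i l)"
    by (simp add: rotate_rev_rotate rotate_rotate mult_2)
  then have "rev (rotate i l) = rotate i l"
    using inj_rotate by (rule injD[rotated])
  then show "palindromic l" unfolding palindromic_def by auto
qed

lemma palindromic_rotate1: "palindromic (rotate1 l) \<longleftrightarrow> palindromic l"
proof -
  have "palindromic l" if "palindromic (rotate1 l)"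
    using that unfolding palindromic_def by (metis rotate_Suc rotate1_rotate_swap)
  moreover have "palindromic (rotate1 l)" if pal: "palindromic l"
  proof (cases "l = []")
    case False
    obtain r where r: "rev (rotate r l) = rotate r l" using pal by (auto simp: palindromic_def)
    have "rotate (r + length l - 1) (rotate1 l) = rotate (r + length l) l"
      using False by (metis One_nat_def Suc_diff_1 add_gr_0 length_greater_0_conv rotate1_rotate_swap rotate_Suc)
    also have "\<dots> = rotate r l" by (metis mod_add_self2 rotate_conv_mod)
    finally show ?thesis using r unfolding palindromic_def by metis
  qed (use pal in simp)
  ultimately show ?thesis by blast
qed

lemma count_runs_palindromic:
  assumes "even (length l)" "palindromic l"
  shows "count_list (runs l) True = count_list (runs l) False"
proof (cases "l = []")
  case False
  have rot: "count_list (runs (rotate r l)) True = count_list (runs (rotate r l)) False \<longleftrightarrow>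
    count_list (runs l) True = count_list (runs l) False" for r
  proof (induction r)
    case (Suc r)
    then show ?case
      using count_runs_even_period_rotate1[of "rotate r l"] assms(1) False
      by (auto simp: even_period_def rotate_Suc)
  qed simp
  obtain r where r: "rev (rotate r l) = rotate r l"
    using assms(2) by (auto simp: palindromic_def)
  have "runs (rotate r l) = map Not (rev (runs (rotate r l)))"
    using runs_rev[of "rotate r l"] assms(1) by (simp add: r)
  then have "count_list (runs (rotate r l)) True = count_list (map Not (rev (runs (rotate r l)))) True"
    by (rule arg_cong)
  then show ?thesis using rot[of r] by (simp add: count_list_map_Not)
qed simp

lemma count_runs_True: "count_list (runs l) True = (\<Sum>i | i \<in> {1..length l} \<and> odd i. l ! (i - 1))"
proof -
  have "(\<Sum>i | i \<in> {1..length l} \<and> odd i. l ! (i - 1)) = (\<Sum>i=1..length l. if odd i then l ! (i - 1) else 0)"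
    by (rule sum.inter_filter) simp
  also have "\<dots> = (\<Sum>i<length l. if odd (Suc i) then l ! (Suc i - 1) else 0)"
    unfolding One_nat_def by (rule sum.atLeast1_atMost_eq)
  finally show ?thesis by (simp add: count_runs cong: if_cong)
qed

lemma count_runs_False: "count_list (runs l) False = (\<Sum>i | i \<in> {1..length l} \<and> even i. l ! (i - 1))"
proof -
  have "(\<Sum>i | i \<in> {1..length l} \<and> even i. l ! (i - 1)) = (\<Sum>i=1..length l. if even i then l ! (i - 1) else 0)"
    by (rule sum.inter_filter) simp
  also have "\<dots> = (\<Sum>i<length l. if even (Suc i) then l ! (Suc i - 1) else 0)"
    unfolding One_nat_def by (rule sum.atLeast1_atMost_eq)
  finally show ?thesis by (simp add: count_runs cong: if_cong)
qed

lemma sum_list_1_based: "sum_list l = (\<Sum>i\<in>{1..length l}. l ! (i - 1))"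
  by (simp add: sum_list_sum_nth atLeast0LessThan sum.atLeast1_atMost_eq)

section \<open>The slow continued fraction map\<close>

text \<open>On positive numbers this is the subtractive continued fraction algorithm, with \<open>x - 1\<close> and
\<open>x / (1 - x)\<close> exchanged by \<open>x \<mapsto> 1 / x\<close>. The branch for negative \<open>x\<close> is chosen so that translates and negative
reciprocals end in the same orbit.\<close>

definition slow :: "real \<Rightarrow> real" where
  "slow x = (if x < 0 then x + 1 else if x < 1 then x / (1 - x) else x - 1)"

definition gauss :: "real \<Rightarrow> real" where
  "gauss x = 1 / frac x"

definition pos_irrat :: "real set" where
  "pos_irrat = {x. x > 0 \<and> x \<notin> \<rat>}"

lemma cf_quot_gauss: "cf_quot x i = \<lfloor>(gauss ^^ i) x\<rfloor>"
  by (simp add: cf_quot_def gauss_def[abs_def])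

lemma irrat_inverse: "(x::real) \<notin> \<rat> \<Longrightarrow> 1 / x \<notin> \<rat>"
  using Rats_inverse[of "1 / x"] by (auto simp: inverse_eq_divide)

lemma irrat_add_int: "(x::real) \<notin> \<rat> \<Longrightarrow> x + of_int i \<notin> \<rat>"
  using Rats_diff[of "x + of_int i" "of_int i"] by auto

lemma irrat_slow:
  assumes "x \<notin> \<rat>"
  shows "slow x \<notin> \<rat>"
proof -
  have 1: "x + 1 \<notin> \<rat>" "x - 1 \<notin> \<rat>"
    using irrat_add_int[OF assms, of 1] irrat_add_int[OF assms, of "- 1"] by auto
  have "x / (1 - x) \<notin> \<rat>" if "x > 0" "x < 1"
  proof -
    have "1 / x - 1 \<notin> \<rat>"
      using irrat_add_int[OF irrat_inverse[OF assms], of "- 1"] by simp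
    then have "1 / (1 / x - 1) \<notin> \<rat>"
      by (rule irrat_inverse)
    also have "1 / (1 / x - 1) = x / (1 - x)"
      using that by (simp add: field_simps)
    finally show ?thesis .
  qed
  moreover have "x \<noteq> 0"
    using assms by auto
  ultimately show ?thesis
    using 1 by (auto simp: slow_def)
qed

lemma pos_irrat_slow: "x \<in> pos_irrat \<Longrightarrow> slow x \<in> pos_irrat"
proof -
  assume x: "x \<in> pos_irrat"
  then have "x \<noteq> 1" by (auto simp: pos_irrat_def)
  with x show ?thesis
    using irrat_slow[of x] by (auto simp: pos_irrat_def slow_def)
qed

lemma pos_irrat_neq_1: "x \<in> pos_irrat \<Longrightarrow> x \<noteq> 1"
  by (auto simp: pos_irrat_def)

lemma pos_irrat_gauss:
  assumes "x \<in> pos_irrat"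
  shows "gauss x \<in> pos_irrat" and "gauss x > 1"
proof -
  have "frac x \<notin> \<rat>" using assms by (simp add: pos_irrat_def)
  moreover from this have "frac x \<noteq> 0" by (metis Rats_0)
  then have "frac x > 0" by (simp add: frac_gt_0_iff frac_eq_0_iff)
  moreover have "frac x < 1" by (rule frac_lt_1)
  ultimately show "gauss x \<in> pos_irrat" "gauss x > 1"
    using irrat_inverse[of "frac x"] by (auto simp: gauss_def pos_irrat_def)
qed

lemma pos_irrat_funpow_slow: "x \<in> pos_irrat \<Longrightarrow> (slow ^^ n) x \<in> pos_irrat"
  by (induction n) (auto intro: pos_irrat_slow)

lemma pos_irrat_funpow_gauss: "x \<in> pos_irrat \<Longrightarrow> (gauss ^^ n) x \<in> pos_irrat"
  by (induction n) (auto intro: pos_irrat_gauss)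

lemma funpow_gauss_gt_1: "x \<in> pos_irrat \<Longrightarrow> x > 1 \<Longrightarrow> (gauss ^^ n) x > 1"
  by (induction n) (auto intro: pos_irrat_gauss pos_irrat_funpow_gauss)

text \<open>Inversion exchanges the two branches.\<close>

lemma slow_inverse:
  assumes "x \<in> pos_irrat"
  shows "slow (1 / x) = 1 / slow x"
proof -
  have "x > 0" "x \<noteq> 1" using assms by (auto simp: pos_irrat_def)
  then show ?thesis by (auto simp: slow_def field_simps)
qed

lemma funpow_slow_inverse:
  "x \<in> pos_irrat \<Longrightarrow> (slow ^^ n) (1 / x) = 1 / (slow ^^ n) x"
  by (induction n) (auto simp: slow_inverse pos_irrat_funpow_slow)

section \<open>Itineraries and partial quotients\<close>

text \<open>The letter \<open>True\<close> stands for the branch \<open>x \<mapsto> x - 1\<close>, which corresponds to the operator \<open>opA\<close> on forms, and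
\<open>False\<close> for the branch corresponding to \<open>opB\<close>.\<close>

definition itin :: "nat \<Rightarrow> real \<Rightarrow> bool list" where
  "itin n x = map (\<lambda>i. (slow ^^ i) x > 1) [0..<n]"

lemma length_itin [simp]: "length (itin n x) = n"
  by (simp add: itin_def)

lemma nth_itin: "i < n \<Longrightarrow> itin n x ! i = ((slow ^^ i) x > 1)"
  by (simp add: itin_def)

lemma itin_Suc: "itin (Suc n) x = (x > 1) # itin n (slow x)"
  by (simp add: itin_def map_upt_Suc funpow_swap1 del: upt_Suc)

lemma itin_add: "itin (a + n) x = itin a x @ itin n ((slow ^^ a) x)"
  by (induction a arbitrary: x) (simp_all add: itin_Suc funpow_swap1, simp add: itin_def)

lemma itin_inverse: "x \<in> pos_irrat \<Longrightarrow> itin n (1 / x) = map Not (itin n x)"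
proof (induction n arbitrary: x)
  case (Suc n)
  have "1 / x > 1 \<longleftrightarrow> \<not> x > 1"
    using Suc.prems by (auto simp: pos_irrat_def not_less field_simps le_less)
  then show ?case
    using Suc by (simp add: itin_Suc slow_inverse pos_irrat_slow)
qed (simp add: itin_def)

lemma slow_down:
  assumes "real i < x"
  shows "(slow ^^ i) x = x - real i"
  using assms by (induction i) (auto simp: slow_def)

lemma itin_floor:
  assumes "x \<in> pos_irrat"
  shows "(slow ^^ nat \<lfloor>x\<rfloor>) x = 1 / gauss x"
    and "itin (nat \<lfloor>x\<rfloor>) x = replicate (nat \<lfloor>x\<rfloor>) True"
proof -
  have "x \<notin> \<rat>" "x > 0" using assms by (auto simp: pos_irrat_def)
  have "of_int \<lfloor>x\<rfloor> \<noteq> x" using \<open>x \<notin> \<rat>\<close> by (metis Rats_of_int)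
  then have lt: "real (nat \<lfloor>x\<rfloor>) < x"
    using \<open>x > 0\<close> by linarith
  show "(slow ^^ nat \<lfloor>x\<rfloor>) x = 1 / gauss x"
    using slow_down[OF lt] \<open>x > 0\<close> by (simp add: gauss_def frac_def)
  have "(slow ^^ i) x > 1" if "i < nat \<lfloor>x\<rfloor>" for i
  proof -
    have "real (Suc i) \<le> real (nat \<lfloor>x\<rfloor>)" using that by linarith
    then show ?thesis using slow_down[of i x] lt by simp
  qed
  then show "itin (nat \<lfloor>x\<rfloor>) x = replicate (nat \<lfloor>x\<rfloor>) True"
    by (auto simp: itin_def intro!: nth_equalityI)
qed

text \<open>One partial quotient \<open>a\<close> takes \<open>a\<close> subtractions of 1, after which \<open>1 / gauss x\<close> remains. As \<open>slow\<close> commutes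
with inversion, the next quotient is spelled by the opposite letter, and so on.\<close>

lemma itin_cf_prefix:
  assumes "x \<in> pos_irrat" and "\<And>i. i < length l \<Longrightarrow> cf_quot x i = int (l ! i)"
  shows "itin (sum_list l) x = runs l \<and>
    (slow ^^ sum_list l) x = (if even (length l) then (gauss ^^ length l) x
                               else 1 / (gauss ^^ length l) x)"
  using assms
proof (induction l arbitrary: x)
  case Nil
  then show ?case by (simp add: itin_def)
next
  case (Cons a l)
  have a: "nat \<lfloor>x\<rfloor> = a"
    using Cons.prems(2)[of 0] by (simp add: cf_quot_gauss)
  have g: "gauss x \<in> pos_irrat" using Cons.prems(1) by (rule pos_irrat_gauss)
  have "cf_quot (gauss x) i = int (l ! i)" if "i < length l" for i
    using Cons.prems(2)[of "Suc i"] that by (simp add: cf_quot_gauss funpow_swap1)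
  from Cons.IH[OF g this]
  have IH: "itin (sum_list l) (gauss x) = runs l"
    "(slow ^^ sum_list l) (gauss x) = (if even (length l) then (gauss ^^ length l) (gauss x)
                               else 1 / (gauss ^^ length l) (gauss x))"
    by auto
  have s: "(slow ^^ a) x = 1 / gauss x" and r: "itin a x = replicate a True"
    using itin_floor[OF Cons.prems(1)] a by auto
  have "itin (sum_list (a # l)) x = replicate a True @ itin (sum_list l) (1 / gauss x)"
    by (simp add: itin_add s r)
  then have 1: "itin (sum_list (a # l)) x = runs (a # l)"
    by (simp add: itin_inverse[OF g] IH(1))
  have "(slow ^^ sum_list (a # l)) x = (slow ^^ sum_list l) ((slow ^^ a) x)"
    by (simp add: add.commute[of a] funpow_add)
  also have "\<dots> = 1 / (slow ^^ sum_list l) (gauss x)"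
    by (simp add: s funpow_slow_inverse[OF g])
  also have "\<dots> = (if even (length (a # l)) then (gauss ^^ length (a # l)) x
                               else 1 / (gauss ^^ length (a # l)) x)"
    by (simp add: IH(2) funpow_swap1)
  finally show ?case using 1 by blast
qed

text \<open>Keeps track, inside the orbit of \<open>y > 1\<close>, of the run \<open>j\<close> to which time \<open>u\<close> belongs and of the number \<open>v\<close>
of letters of that run already spent.\<close>

lemma slow_position:
  assumes "y \<in> pos_irrat" "y > 1"
  shows "\<exists>j v. int u = (\<Sum>i<j. cf_quot y i) + int v \<and> int v < cf_quot y j \<and>
    (slow ^^ u) y = (if even j then (gauss ^^ j) y - v else 1 / ((gauss ^^ j) y - v)) \<and>
    (v > 0 \<longrightarrow> ((slow ^^ (u - 1)) y > 1) = even j)"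
proof (induction u)
  case 0
  show ?case
    using assms by (intro exI[of _ 0]) (auto simp: cf_quot_gauss)
next
  case (Suc u)
  then obtain j v where u: "int u = (\<Sum>i<j. cf_quot y i) + int v" and v: "int v < cf_quot y j"
    and s: "(slow ^^ u) y = (if even j then (gauss ^^ j) y - v else 1 / ((gauss ^^ j) y - v))"
    by blast
  define z where "z = (gauss ^^ j) y"
  have z: "z \<in> pos_irrat" using assms by (simp add: z_def pos_irrat_funpow_gauss)
  have fl: "cf_quot y j = \<lfloor>z\<rfloor>" by (simp add: cf_quot_gauss z_def)
  have "z - v > 1"
  proof -
    have "of_int \<lfloor>z\<rfloor> \<noteq> z" using z by (metis Rats_of_int mem_Collect_eq pos_irrat_def)
    then show ?thesis using v fl by linarith
  qed
  moreover have "z - v \<in> pos_irrat"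
    using z calculation irrat_add_int[of z "- int v"] by (auto simp: pos_irrat_def)
  ultimately have s': "(slow ^^ Suc u) y = (if even j then z - v - 1 else 1 / (z - v - 1))"
    and letter: "((slow ^^ u) y > 1) = even j"
    using s by (auto simp: z_def[symmetric] slow_inverse) (auto simp: slow_def)
  show ?case
  proof (cases "int (Suc v) < cf_quot y j")
    case True
    then show ?thesis
      using u s' letter z_def by (intro exI[of _ j] exI[of _ "Suc v"]) (auto simp: algebra_simps)
  next
    case False
    then have *: "cf_quot y j = int (Suc v)" using v by linarith
    then have "z - v - 1 = 1 / (gauss ^^ Suc j) y"
      using fl by (simp add: gauss_def frac_def flip: z_def)
    moreover have "(gauss ^^ Suc j) y > 1"
      using assms funpow_gauss_gt_1 by blast
    then have "cf_quot y (Suc j) > 0" by (simp add: cf_quot_gauss)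
    ultimately show ?thesis
      using u s' * by (intro exI[of _ "Suc j"] exI[of _ 0]) auto
  qed
qed

text \<open>Where the letter changes, a run has just been completed, so the orbit meets the orbit of the Gauss
map (up to inversion). The parity of the number of runs tells which letter begins.\<close>

lemma slow_turn:
  assumes "y \<in> pos_irrat" "y > 1"
    and "((slow ^^ Suc u) y > 1) \<noteq> ((slow ^^ u) y > 1)"
  shows "\<exists>j. even j = ((slow ^^ Suc u) y > 1) \<and> int (Suc u) = (\<Sum>i<j. cf_quot y i) \<and>
    (slow ^^ Suc u) y = (if even j then (gauss ^^ j) y else 1 / (gauss ^^ j) y)"
proof -
  obtain j v where u: "int (Suc u) = (\<Sum>i<j. cf_quot y i) + int v" and v: "int v < cf_quot y j"
    and s: "(slow ^^ Suc u) y = (if even j then (gauss ^^ j) y - v else 1 / ((gauss ^^ j) y - v))"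
    and p: "v > 0 \<longrightarrow> ((slow ^^ u) y > 1) = even j"
    using slow_position[OF assms(1,2), of "Suc u"] by fastforce
  have "of_int \<lfloor>(gauss ^^ j) y\<rfloor> \<noteq> (gauss ^^ j) y"
    using pos_irrat_funpow_gauss[OF assms(1), of j] by (metis Rats_of_int mem_Collect_eq pos_irrat_def)
  then have "(gauss ^^ j) y - v > 1"
    using v unfolding cf_quot_gauss by linarith
  then have e: "((slow ^^ Suc u) y > 1) = even j"
    unfolding s by auto
  with p assms(3) have "v = 0" by auto
  with u s e show ?thesis by (intro exI[of _ j]) auto
qed

text \<open>All partial quotients of \<open>y > 1\<close> are at least 1, so \<open>Suc u\<close> of them spell more than \<open>u\<close> letters.\<close>

lemma same_cf_same_letters:
  assumes "y \<in> pos_irrat" "y > 1" "z \<in> pos_irrat" "\<And>i. cf_quot y i = cf_quot z i"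
  shows "((slow ^^ u) y > 1) = ((slow ^^ u) z > 1)"
proof -
  define l where "l = map (\<lambda>i. nat (cf_quot y i)) [0..<Suc u]"
  have pos: "cf_quot y i > 0" for i
    using funpow_gauss_gt_1[OF assms(1,2), of i] by (simp add: cf_quot_gauss)
  have l: "cf_quot y i = int (l ! i)" if "i < length l" for i
    using that pos[of i] by (simp add: l_def less_imp_le del: upt_Suc)
  have "(\<Sum>i<Suc u. 1) \<le> (\<Sum>i<Suc u. nat (cf_quot y i))"
    using pos by (intro sum_mono) (simp add: Suc_le_eq)
  also have "\<dots> = sum_list l"
    by (simp add: l_def sum_list_sum_nth atLeast0LessThan del: upt_Suc sum.lessThan_Suc)
  finally have u: "u < sum_list l" by simp
  have "itin (sum_list l) y = itin (sum_list l) z"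
    using itin_cf_prefix[OF assms(1) l] itin_cf_prefix[OF assms(3), of l] l assms(4) by simp
  then show ?thesis using nth_itin[OF u] by metis
qed

section \<open>An eventually periodic itinerary determines its number\<close>

text \<open>On the branch \<open>x \<mapsto> x / (1 - x)\<close> the distance is divided by \<open>(1 - x) * (1 - z) < 1\<close>.\<close>

lemma slow_expanding:
  assumes "x \<in> pos_irrat" "z \<in> pos_irrat" "(x > 1) = (z > 1)" "x \<noteq> z"
  shows "\<bar>slow x - slow z\<bar> \<ge> \<bar>x - z\<bar>"
    and "\<not> x > 1 \<Longrightarrow> \<bar>slow x - slow z\<bar> > \<bar>x - z\<bar>"
proof -
  have *: "\<bar>slow x - slow z\<bar> > \<bar>x - z\<bar>" if "\<not> x > 1"
  proof -
    have x: "0 < x" "x < 1" "0 < z" "z < 1"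
      using assms that by (auto simp: pos_irrat_def not_less le_less)
    then have d: "0 < (1 - x) * (1 - z)" by simp
    have "(1 - x) * (1 - z) < 1 * 1"
      using x by (intro mult_strict_mono) auto
    then have "\<bar>x - z\<bar> * ((1 - x) * (1 - z)) < \<bar>x - z\<bar> * 1"
      using assms(4) by (intro mult_strict_left_mono) auto
    moreover have "slow x - slow z = (x - z) / ((1 - x) * (1 - z))"
      using x by (simp add: slow_def field_simps)
    ultimately show ?thesis
      using d by (simp add: pos_less_divide_eq)
  qed
  then show "\<not> x > 1 \<Longrightarrow> \<bar>slow x - slow z\<bar> > \<bar>x - z\<bar>" .
  show "\<bar>slow x - slow z\<bar> \<ge> \<bar>x - z\<bar>"
  proof (cases "x > 1")
    case True
    then show ?thesis using assms by (simp add: slow_def)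
  qed (use * in auto)
qed

text \<open>If the two numbers differ, their distance never decreases along the common itinerary and increases strictly
at every \<open>False\<close>. Over a common period it returns to its value, so only \<open>True\<close> occurs; but
repeated subtraction of 1 is not periodic.\<close>

lemma itinerary_determines:
  assumes "x \<in> pos_irrat" "z \<in> pos_irrat"
    and same: "\<And>i. ((slow ^^ i) x > 1) = ((slow ^^ i) z > 1)"
    and per: "(slow ^^ r) ((slow ^^ j) x) = (slow ^^ j) x"
      "(slow ^^ r) ((slow ^^ j) z) = (slow ^^ j) z" and "r > 0"
  shows "x = z"
proof (rule ccontr)
  assume "x \<noteq> z"
  define d where "d i = \<bar>(slow ^^ i) x - (slow ^^ i) z\<bar>" for i
  have step: "d i > 0 \<Longrightarrow> d (Suc i) \<ge> d i"
    "d i > 0 \<Longrightarrow> \<not> (slow ^^ i) x > 1 \<Longrightarrow> d (Suc i) > d i" for i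
    using slow_expanding[OF pos_irrat_funpow_slow[OF assms(1)] pos_irrat_funpow_slow[OF assms(2)]
        same, of i] by (auto simp: d_def)
  have pos: "d i > 0" for i
  proof (induction i)
    case 0
    then show ?case using \<open>x \<noteq> z\<close> by (simp add: d_def)
  next
    case (Suc i)
    then show ?case using step(1)[of i] by linarith
  qed
  have mono: "i \<le> i' \<Longrightarrow> d i \<le> d i'" for i i'
    using step(1) pos by (simp add: lift_Suc_mono_le)
  have eq: "d (r + j) = d j"
    using per by (simp add: d_def funpow_add)
  \<comment> \<open>A \<open>False\<close> within the period would make the distance grow strictly.\<close>
  have A: "(slow ^^ (i + j)) x > 1" if "i < r" for i
  proof (rule ccontr)
    assume "\<not> (slow ^^ (i + j)) x > 1"
    then have "d (Suc (i + j)) > d (i + j)" using step(2) pos by blast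
    moreover have "d (i + j) \<ge> d j" "d (r + j) \<ge> d (Suc (i + j))"
      using that by (auto intro!: mono)
    ultimately show False using eq by linarith
  qed
  have "(slow ^^ (i + j)) x = (slow ^^ j) x - real i" if "i \<le> r" for i
    using that
  proof (induction i)
    case (Suc i)
    then have "(slow ^^ (i + j)) x > 1" "(slow ^^ (i + j)) x = (slow ^^ j) x - real i"
      using A[of i] by auto
    moreover from this have "slow ((slow ^^ (i + j)) x) = (slow ^^ (i + j)) x - 1"
      by (simp add: slow_def)
    ultimately show ?case by simp
  qed simp
  from this[of r] per(1) \<open>r > 0\<close> show False by (simp add: funpow_add)
qed

section \<open>Numbers with a common tail\<close>

definition merge :: "real \<Rightarrow> real \<Rightarrow> bool" where
  "merge x y \<longleftrightarrow> (\<exists>i j. (slow ^^ i) x = (slow ^^ j) y)"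

lemma merge_refl: "merge x x"
  unfolding merge_def by blast

lemma merge_sym: "merge x y \<Longrightarrow> merge y x"
  unfolding merge_def by metis

lemma merge_trans:
  assumes "merge x y" "merge y z"
  shows "merge x z"
proof -
  obtain i j where 1: "(slow ^^ i) x = (slow ^^ j) y"
    using assms by (auto simp: merge_def)
  obtain i' j' where 2: "(slow ^^ i') y = (slow ^^ j') z"
    using assms by (auto simp: merge_def)
  have "(slow ^^ (i' + i)) x = (slow ^^ (i' + j)) y"
    by (simp add: funpow_add 1)
  also have "\<dots> = (slow ^^ (j + i')) y" by (simp add: add.commute)
  also have "\<dots> = (slow ^^ (j + j')) z" by (simp add: funpow_add 2)
  finally show ?thesis unfolding merge_def by blast
qed

lemma merge_slow: "merge ((slow ^^ n) x) x"
  unfolding merge_def by (intro exI[of _ 0] exI[of _ n]) auto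

lemma merge_shift:
  assumes "x \<notin> \<rat>"
  shows "merge (x - 1) x"
proof (cases "x > 1")
  case True
  then show ?thesis using merge_slow[of 1 x] by (simp add: slow_def)
next
  case False
  then have "x < 1" using assms by (metis Rats_1 linorder_neqE_linordered_idom)
  then have "slow (x - 1) = x" by (simp add: slow_def)
  then show ?thesis using merge_sym[OF merge_slow[of 1 "x - 1"]] by simp
qed

text \<open>For \<open>x > 1\<close> the two orbits meet at \<open>x - 1\<close>. For \<open>x < 1\<close> the map \<open>x \<mapsto> - 1 / x\<close> carries \<open>slow x\<close> to \<open>slow (- 1 / x)\<close>, and
\<open>slow\<close> lowers the integer part of \<open>1 / x\<close>.\<close>

lemma merge_neg_inverse_pos:
  assumes "x \<in> pos_irrat"
  shows "merge (- 1 / x) x"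
  using assms
proof (induction "nat \<lfloor>1 / x\<rfloor>" arbitrary: x rule: less_induct)
  case less
  have x: "x > 0" "x \<noteq> 1" using less.prems by (auto simp: pos_irrat_def)
  have s: "slow (- 1 / x) = 1 - 1 / x" using x by (simp add: slow_def)
  show ?case
  proof (cases "x > 1")
    case True
    then have "slow (1 - 1 / x) = slow x" by (simp add: slow_def field_simps)
    then have "(slow ^^ 2) (- 1 / x) = (slow ^^ 1) x"
      by (simp add: s[simplified] numeral_2_eq_2)
    then show ?thesis unfolding merge_def by blast
  next
    case False
    then have x1: "x < 1" using x by simp
    then have e: "1 / slow x = 1 / x - 1" using x by (simp add: slow_def field_simps)
    have "1 / x > 1" using x x1 by simp
    then have "nat \<lfloor>1 / slow x\<rfloor> < nat \<lfloor>1 / x\<rfloor>" unfolding e by linarith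
    from less.hyps[OF this] have "merge (- 1 / slow x) (slow x)"
      using less.prems pos_irrat_slow by blast
    moreover have "- 1 / slow x = slow (- 1 / x)"
      unfolding s using e by (simp add: minus_divide_left[symmetric] del: minus_divide_left)
    ultimately show ?thesis
      using merge_slow[of 1] merge_trans merge_sym by (metis funpow_0 funpow_simps_right(2) One_nat_def comp_apply)
  qed
qed

lemma merge_neg_inverse:
  assumes "x \<notin> \<rat>"
  shows "merge (- 1 / x) x"
proof (cases "x > 0")
  case True
  then show ?thesis using assms merge_neg_inverse_pos by (simp add: pos_irrat_def)
next
  case False
  have "x \<noteq> 0" using assms by auto
  then have "- 1 / x \<in> pos_irrat"
    using False assms irrat_inverse[of x] by (auto simp: pos_irrat_def divide_neg_neg)
  from merge_neg_inverse_pos[OF this] show ?thesis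
    by (simp add: merge_sym)
qed

text \<open>Omitting an odd number of partial quotients leaves the tail of \<open>1 / x\<close> rather than that of \<open>x\<close>.\<close>

lemma merge_funpow_gauss:
  assumes "x \<in> pos_irrat"
  shows "merge ((gauss ^^ n) x) (if even n then x else 1 / x)"
proof -
  define w where "w = map (\<lambda>i. nat (cf_quot x i)) [0..<n]"
  let ?z = "(gauss ^^ n) x"
  have "cf_quot x i = int (w ! i)" if "i < length w" for i
    using that pos_irrat_funpow_gauss[OF assms, of i]
    by (simp add: w_def cf_quot_gauss pos_irrat_def)
  from itin_cf_prefix[OF assms this]
  have s: "(slow ^^ sum_list w) x = (if even n then ?z else 1 / ?z)"
    by (simp add: w_def)
  then have "(slow ^^ sum_list w) (if even n then x else 1 / x) = ?z"
    by (simp add: funpow_slow_inverse[OF assms])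
  then show ?thesis using merge_slow by metis
qed

section \<open>Integer forms under the modular group\<close>

definition qf_S :: "int bqf \<Rightarrow> int bqf" where
  "qf_S = qf_subst 0 1 (- 1) 0"

lemma qf_S_simp [simp]: "qf_S (m, n, k) = (n, m, - k)"
  by (simp add: qf_S_def)

lemma qf_subst_id [simp]: "qf_subst 1 0 0 1 f = f"
  by (cases f) simp

lemma qf_subst_qf_subst:
  fixes f :: "int bqf"
  shows "qf_subst a' b' c' d' (qf_subst a b c d f) =
    qf_subst (a * a' + b * c') (a * b' + b * d') (c * a' + d * c') (c * b' + d * d') f"
  by (cases f) (simp add: algebra_simps power2_eq_square)

lemma qf_disc_subst:
  fixes f :: "int bqf"
  assumes "a * d - b * c = 1"
  shows "qf_disc (qf_subst a b c d f) = qf_disc f"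
proof -
  have "qf_disc (qf_subst a b c d f) = (a * d - b * c)^2 * qf_disc f"
    by (cases f) (simp add: algebra_simps power2_eq_square)
  then show ?thesis using assms by simp
qed

lemma qf_class_disc:
  assumes "g \<in> qf_class f"
  shows "qf_disc g = qf_disc f"
proof -
  obtain a b c d where "g = qf_subst a b c d f" "a * d - b * c = 1"
    using assms by (auto simp: qf_class_def)
  then show ?thesis by (simp only: qf_disc_subst)
qed

lemma qf_class_refl: "f \<in> qf_class f"
  unfolding qf_class_def mem_Collect_eq
  by (rule exI[of _ 1], rule exI[of _ 0], rule exI[of _ 0], rule exI[of _ 1]) simp

lemma qf_class_subst:
  assumes "g \<in> qf_class f" "a * d - b * c = 1"
  shows "qf_subst a b c d g \<in> qf_class f"
proof -
  obtain a' b' c' d' where g: "g = qf_subst a' b' c' d' f" and det: "a' * d' - b' * c' = 1"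
    using assms(1) by (auto simp: qf_class_def)
  have "(a' * a + b' * c) * (c' * b + d' * d) - (a' * b + b' * d) * (c' * a + d' * c)
      = (a' * d' - b' * c') * (a * d - b * c)"
    by (simp add: algebra_simps)
  then show ?thesis
    unfolding g qf_subst_qf_subst qf_class_def using det assms(2) by auto
qed

lemma qf_class_sym: "g \<in> qf_class f \<Longrightarrow> f \<in> qf_class g"
proof -
  assume "g \<in> qf_class f"
  then obtain a b c d where g: "g = qf_subst a b c d f" and det: "a * d - b * c = 1"
    by (auto simp: qf_class_def)
  have "qf_subst d (- b) (- c) a g = qf_subst (a * d - b * c) 0 0 (a * d - b * c) f"
    by (simp add: g qf_subst_qf_subst mult.commute)
  then have "f = qf_subst d (- b) (- c) a g"
    by (simp add: det)
  then show ?thesis using qf_class_subst[OF qf_class_refl, of d a "- b" "- c" g] det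
    by (simp add: mult.commute)
qed

lemma qf_class_trans:
  assumes "g \<in> qf_class f" "h \<in> qf_class g"
  shows "h \<in> qf_class f"
proof -
  obtain a b c d where "h = qf_subst a b c d g" "a * d - b * c = 1"
    using assms(2) by (auto simp: qf_class_def)
  then show ?thesis using qf_class_subst[OF assms(1)] by simp
qed

lemma qf_class_eq: "g \<in> qf_class f \<Longrightarrow> qf_class g = qf_class f"
  using qf_class_trans qf_class_sym by blast

lemma qf_class_opA: "opA g \<in> qf_class f \<longleftrightarrow> g \<in> qf_class f"
proof -
  have "opA g \<in> qf_class g"
    unfolding opA_subst by (intro qf_class_subst qf_class_refl) simp
  then show ?thesis using qf_class_trans qf_class_sym by blast
qed

lemma qf_class_opB: "opB g \<in> qf_class f \<longleftrightarrow> g \<in> qf_class f"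
proof -
  have "opB g \<in> qf_class g"
    unfolding opB_subst by (intro qf_class_subst qf_class_refl) simp
  then show ?thesis using qf_class_trans qf_class_sym by blast
qed

lemma qf_class_S: "qf_S g \<in> qf_class f \<longleftrightarrow> g \<in> qf_class f"
proof -
  have "qf_S g \<in> qf_class g"
    unfolding qf_S_def by (intro qf_class_subst qf_class_refl) simp
  then show ?thesis using qf_class_trans qf_class_sym by blast
qed

section \<open>The step map on indefinite forms of nonsquare discriminant\<close>

lemma irrat_sqrt_nonsquare:
  fixes D :: int
  assumes "\<not> is_square D" "D > 0"
  shows "sqrt (real_of_int D) \<notin> \<rat>"
proof
  assume "sqrt (real_of_int D) \<in> \<rat>"
  then obtain p q :: int where q: "q > 0" and cop: "coprime p q"
    and eq: "sqrt (real_of_int D) = of_int p / of_int q"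
    by (rule Rats_cases')
  have "(real_of_int p / of_int q)^2 = of_int D"
    using assms(2) by (simp flip: eq)
  then have "real_of_int (p^2) = of_int (D * q^2)"
    using q by (simp add: power_divide field_simps)
  then have e: "p^2 = D * q^2" by linarith
  then have "q^2 dvd p^2" by simp
  then have "q dvd p" by simp
  with cop have "is_unit q" by (meson coprime_common_divisor dvd_refl)
  with q have "q = 1" by simp
  with e have "D = p^2" by simp
  with assms(1) show False by (auto intro: is_nth_powerI)
qed

definition H0_forms :: "int \<Rightarrow> int bqf set" where
  "H0_forms D = {(m, n, k). qf_disc (m, n, k) = D \<and> m > 0 \<and> n < 0}"

text \<open>The value \<open>f(1,1) = m + n + k\<close> replaces the coefficient whose sign it shares.\<close>

definition step :: "int bqf \<Rightarrow> int bqf" where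
  "step f = (if qf_eval f 1 1 > 0 then opB f else opA f)"

text \<open>The discriminant is \<open>k\<^sup>2 + 4 * m * \<bar>n\<bar>\<close>, a sum of nonnegative terms that bound the coefficients.\<close>

lemma finite_H0_forms: "finite (H0_forms D)"
proof (rule finite_subset)
  show "H0_forms D \<subseteq> {0..D} \<times> {-D..0} \<times> {-D..D}"
  proof
    fix f assume "f \<in> H0_forms D"
    then obtain m n k where f: "f = (m, n, k)" and D: "k^2 - 4 * m * n = D" and s: "m > 0" "n < 0"
      by (auto simp: H0_forms_def)
    have "m * 1 \<le> m * (- n)" "1 * (- n) \<le> m * (- n)"
      using s by (intro mult_left_mono mult_right_mono; simp)+
    then have "m \<le> - (m * n)" "- n \<le> - (m * n)"
      by (simp_all only: mult_1 mult_1_right mult_minus_right)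
    moreover have "k^2 \<ge> \<bar>k\<bar>"
      using self_le_power[of "\<bar>k\<bar>" 2] by (cases "k = 0") auto
    moreover have "k^2 \<ge> 0" by simp
    moreover have "D = k^2 - 4 * (m * n)" using D by simp
    ultimately have "m \<le> D" "- n \<le> D" "\<bar>k\<bar> \<le> D" using s by linarith+
    then show "f \<in> {0..D} \<times> {-D..0} \<times> {-D..D}"
      using D s f by auto
  qed
qed simp

text \<open>A discriminant that is not a square keeps the forms from representing 0 and makes their roots irrational.\<close>

locale nonsquare_disc =
  fixes D :: int
  assumes D_pos: "D > 0" and nonsquare: "\<not> is_square D"
begin

text \<open>A constant instead of the term \<open>sqrt D\<close> keeps the simplifier from rewriting under the root.\<close>

definition sqrtD where "sqrtD = sqrt (real_of_int D)"

lemma sqrtD: "sqrtD > 0" "sqrtD * sqrtD = real_of_int D" "sqrtD \<notin> \<rat>"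
  using D_pos irrat_sqrt_nonsquare[OF nonsquare D_pos] by (auto simp: sqrtD_def)

text \<open>If one of the values \<open>f(1,0)\<close>, \<open>f(0,1)\<close>, \<open>f(1,1)\<close> vanishes, the discriminant is \<open>k\<^sup>2\<close> or \<open>(m - n)\<^sup>2\<close>.\<close>

lemma coeffs_nonzero:
  assumes "qf_disc (m, n, k) = D"
  shows "m \<noteq> 0" "n \<noteq> 0" "m + n + k \<noteq> 0"
proof -
  have "D \<noteq> x^2" for x
    using nonsquare by (auto intro: is_nth_powerI)
  then have sq: "k^2 - 4 * m * n \<noteq> x^2" for x
    using assms by simp
  show "m \<noteq> 0" "n \<noteq> 0" using sq[of k] by auto
  show "m + n + k \<noteq> 0"
  proof
    assume "m + n + k = 0"
    then have k: "k = - (m + n)" by simp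
    show False using sq[of "m - n"] unfolding k by (simp add: algebra_simps power2_eq_square)
  qed
qed

lemma xi_eq:
  assumes "qf_disc (m, n, k) = D"
  shows "xi_plus (m, n, k) = (sqrtD - real_of_int k) / (2 * real_of_int m)"
  using assms by (simp add: sqrtD_def)

lemma xi_irrat:
  assumes "qf_disc f = D"
  shows "xi_plus f \<notin> \<rat>"
proof -
  obtain m n k where f: "f = (m, n, k)" by (cases f)
  have m: "m \<noteq> 0" using coeffs_nonzero assms f by blast
  have "sqrtD = xi_plus f * (2 * real_of_int m) + real_of_int k"
    using m xi_eq[of m n k] assms by (simp add: f del: xi_plus.simps qf_disc.simps)
  then show ?thesis using sqrtD(3)
    by (metis Rats_add Rats_mult Rats_number_of Rats_of_int)
qed

text \<open>The root determines \<open>m\<close> and \<open>k\<close> by comparing the rational and irrational parts, and then the discriminant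
determines \<open>n\<close>. This is what turns statements about orbits of numbers into statements about forms.\<close>

lemma xi_inj:
  assumes "qf_disc f = D" "qf_disc g = D" "xi_plus f = xi_plus g"
  shows "f = g"
proof -
  obtain m n k where f: "f = (m, n, k)" by (cases f)
  obtain m' n' k' where g: "g = (m', n', k')" by (cases g)
  have nz: "m \<noteq> 0" "m' \<noteq> 0" using coeffs_nonzero assms f g by blast+
  have "(sqrtD - real_of_int k) / (2 * m) = (sqrtD - real_of_int k') / (2 * m')"
    using assms xi_eq[of m n k] xi_eq[of m' n' k'] by (simp add: f g del: xi_plus.simps qf_disc.simps)
  then have e: "sqrtD * (m' - m) = real_of_int (m' * k - m * k')"
    using nz by (simp add: field_simps)
  have "m' = m"
  proof (rule ccontr)
    assume "m' \<noteq> m"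
    then have "sqrtD = real_of_int (m' * k - m * k') / real_of_int (m' - m)"
      using e by (simp add: field_simps)
    then show False using sqrtD(3) by (metis Rats_divide Rats_of_int)
  qed
  moreover from this have "k = k'" using e nz by simp
  ultimately show ?thesis using nz assms(1,2) by (auto simp: f g)
qed

lemma sqrtD_sq:
  assumes "qf_disc (m, n, k) = D"
  shows "sqrtD * sqrtD = real_of_int k * real_of_int k - 4 * real_of_int m * real_of_int n"
proof -
  have "real_of_int D = real_of_int (k^2 - 4 * m * n)" using assms by simp
  then show ?thesis unfolding sqrtD(2) by (simp add: power2_eq_square)
qed

lemma sqrtD_neq_int: "sqrtD \<noteq> real_of_int i"
  using sqrtD(3) by (metis Rats_of_int)

lemma qf_disc_ops [simp]:
  "qf_disc (opA f) = qf_disc (f :: int bqf)" "qf_disc (opB f) = qf_disc f"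
  "qf_disc (qf_S f) = qf_disc f" "qf_disc (qf_anti f) = qf_disc f" "qf_disc (qf_adj f) = qf_disc f"
  by (cases f; simp add: algebra_simps power2_eq_square)+

lemma xi_opA:
  assumes "qf_disc f = D"
  shows "xi_plus (opA f) = xi_plus f - 1"
proof -
  obtain m n k where f: "f = (m, n, k)" by (cases f)
  have "m \<noteq> 0" using coeffs_nonzero assms f by blast
  moreover have "qf_disc (opA f) = D" using assms by simp
  ultimately show ?thesis using assms
    unfolding f opA.simps by (simp add: xi_eq del: qf_disc.simps xi_plus.simps) (simp add: field_simps)
qed

lemma xi_S_aux:
  assumes "qf_disc (m, n, k) = D"
  shows "(sqrtD + real_of_int k) / (2 * real_of_int n) = - 1 / xi_plus (m, n, k)"
proof -
  have nz: "m \<noteq> 0" "n \<noteq> 0" "sqrtD - real_of_int k \<noteq> 0"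
    using coeffs_nonzero assms sqrtD_neq_int[of k] by auto
  have "(sqrtD + k) * (sqrtD - k) = - 4 * real_of_int m * n"
    using sqrtD_sq[OF assms] by (simp add: algebra_simps)
  then show ?thesis
    unfolding xi_eq[OF assms] using nz by (simp add: field_simps)
qed

lemma xi_S:
  assumes "qf_disc f = D"
  shows "xi_plus (qf_S f) = - 1 / xi_plus f"
proof -
  obtain m n k where f: "f = (m, n, k)" by (cases f)
  have "qf_disc (qf_S f) = D" using assms by simp
  then show ?thesis using assms xi_S_aux[of m n k]
    unfolding f qf_S_simp by (simp add: xi_eq del: qf_disc.simps xi_plus.simps)
qed

lemma xi_anti:
  assumes "qf_disc f = D"
  shows "xi_plus (qf_anti f) = 1 / xi_plus f"
proof -
  obtain m n k where f: "f = (m, n, k)" by (cases f)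
  have "qf_disc (qf_anti f) = D" using assms by simp
  then show ?thesis using assms xi_S_aux[of m n k]
    unfolding f qf_anti.simps by (simp add: xi_eq del: qf_disc.simps xi_plus.simps)
qed

lemma H0_disc: "f \<in> H0_forms D \<Longrightarrow> qf_disc f = D"
  by (auto simp: H0_forms_def)

text \<open>The form has a positive value at \<open>(1,0)\<close> and a negative one at \<open>(0,1)\<close>, so its first root is the positive
one, and the sign at \<open>(1,1)\<close> tells on which side of 1 it lies.\<close>

lemma H0_xi:
  assumes "f \<in> H0_forms D"
  shows "xi_plus f \<in> pos_irrat" "xi_plus f > 1 \<longleftrightarrow> \<not> qf_eval f 1 1 > 0"
proof -
  obtain m n k where f: "f = (m, n, k)" by (cases f)
  have d: "qf_disc (m, n, k) = D" and s: "m > 0" "n < 0"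
    using assms by (auto simp: f H0_forms_def)
  note sq = sqrtD_sq[OF d]
  have mn: "real_of_int m * real_of_int n < 0" using s by (simp add: mult_pos_neg)
  have "(real_of_int k)^2 < sqrtD^2"
    using sq mn by (simp add: power2_eq_square)
  then have "real_of_int k < sqrtD"
    using less_imp_le[OF sqrtD(1)] by (rule power2_less_imp_less)
  then have "xi_plus f > 0"
    unfolding f xi_eq[OF d] using s by (intro divide_pos_pos) auto
  moreover have "xi_plus f \<notin> \<rat>"
    by (rule xi_irrat[OF H0_disc[OF assms]])
  ultimately show "xi_plus f \<in> pos_irrat"
    by (simp add: pos_irrat_def)
  have e: "sqrtD^2 - (real_of_int (2 * m + k))^2 = real_of_int (- 4 * m * (m + n + k))"
    unfolding power2_eq_square sq by (simp add: algebra_simps)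
  have "sqrtD > real_of_int (2 * m + k)" if "m + n + k < 0"
  proof (rule power2_less_imp_less)
    have "- 4 * m * (m + n + k) > 0" using that s by (simp add: mult_pos_neg)
    then have "real_of_int (- 4 * m * (m + n + k)) > 0" by (simp only: of_int_0_less_iff)
    then show "(real_of_int (2 * m + k))^2 < sqrtD^2" using e by linarith
  qed (rule less_imp_le[OF sqrtD(1)])
  moreover have "sqrtD < real_of_int (2 * m + k)" if "m + n + k > 0"
  proof (rule power2_less_imp_less)
    have "- 4 * m * (m + n + k) < 0" using that s by (simp add: mult_neg_pos)
    then have "real_of_int (- 4 * m * (m + n + k)) < 0" by (simp only: of_int_less_0_iff)
    then show "sqrtD^2 < (real_of_int (2 * m + k))^2" using e by linarith
    show "0 \<le> real_of_int (2 * m + k)" using that s by linarith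
  qed
  moreover have "m + n + k \<noteq> 0" by (rule coeffs_nonzero(3)[OF d])
  ultimately have "sqrtD > real_of_int (2 * m + k) \<longleftrightarrow> \<not> m + n + k > 0"
    by (metis less_asym linorder_neqE)
  moreover have "xi_plus f > 1 \<longleftrightarrow> sqrtD > real_of_int (2 * m + k)"
    unfolding f xi_eq[OF d] using s by (simp add: field_simps)
  moreover have "qf_eval f 1 1 = m + n + k" by (simp add: f)
  ultimately show "xi_plus f > 1 \<longleftrightarrow> \<not> qf_eval f 1 1 > 0"
    by (simp only:)
qed

lemma xi_opB:
  assumes "f \<in> H0_forms D"
  shows "xi_plus (opB f) = xi_plus f / (1 - xi_plus f)"
proof -
  obtain m n k where f: "f = (m, n, k)" by (cases f)
  have d: "qf_disc (m, n, k) = D" and s: "m > 0" "n < 0"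
    using assms by (auto simp: f H0_forms_def)
  have d': "qf_disc (m + n + k, n, k + 2 * n) = D"
    using qf_disc_ops(2)[of "(m, n, k)"] d by simp
  have nz: "real_of_int (m + n + k) \<noteq> 0" "real_of_int m \<noteq> 0" "2 * m + k - sqrtD \<noteq> 0"
    using coeffs_nonzero[OF d] sqrtD_neq_int[of "2 * m + k"] by (simp_all add: algebra_simps del: of_int_add)
  have "xi_plus f / (1 - xi_plus f) = (sqrtD - k) / (2 * m + k - sqrtD)"
  proof -
    have "1 - xi_plus f = (2 * m + k - sqrtD) / (2 * m)"
      unfolding f xi_eq[OF d] using nz by (simp add: field_simps)
    then show ?thesis unfolding f xi_eq[OF d] using nz by simp
  qed
  also have "\<dots> = (sqrtD - (k + 2 * n)) / (2 * real_of_int (m + n + k))"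
  proof -
    have "(sqrtD - k) * (2 * real_of_int (m + n + k)) = (sqrtD - (k + 2 * n)) * (2 * m + k - sqrtD)"
      using sqrtD_sq[OF d] by (simp add: algebra_simps)
    then show ?thesis using nz by (simp add: frac_eq_eq del: of_int_add)
  qed
  also have "\<dots> = xi_plus (opB f)"
    unfolding f opB.simps xi_eq[OF d'] by simp
  finally show ?thesis by simp
qed

lemma H0_step:
  assumes "f \<in> H0_forms D"
  shows "step f \<in> H0_forms D" "xi_plus (step f) = slow (xi_plus f)"
proof -
  obtain m n k where f: "f = (m, n, k)" by (cases f)
  have d: "qf_disc f = D" "qf_disc (opA f) = D" "qf_disc (opB f) = D"
    using H0_disc[OF assms] by simp_all
  show "step f \<in> H0_forms D"
    using d assms coeffs_nonzero[of m n k]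
    unfolding f by (auto simp: step_def H0_forms_def simp del: qf_disc.simps)
  show "xi_plus (step f) = slow (xi_plus f)"
    using H0_xi[OF assms] xi_opA[OF d(1)] xi_opB[OF assms] pos_irrat_neq_1[of "xi_plus f"]
    by (auto simp: step_def slow_def pos_irrat_def)
qed

lemma H0_funpow_step:
  assumes "f \<in> H0_forms D"
  shows "(step ^^ i) f \<in> H0_forms D \<and> xi_plus ((step ^^ i) f) = (slow ^^ i) (xi_plus f)"
  using assms by (induction i) (auto simp: H0_step)

text \<open>The sign at \<open>(1,-1)\<close> of a form tells by which letter it was reached: it is that of \<open>n < 0\<close> after \<open>opA\<close> and
that of \<open>m > 0\<close> after \<open>opB\<close>.\<close>

lemma step_inj: "inj_on step (H0_forms D)"
proof (rule inj_onI)
  fix f g assume fg: "f \<in> H0_forms D" "g \<in> H0_forms D" "step f = step g"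
  then show "f = g"
    by (cases f; cases g) (auto simp: step_def H0_forms_def split: if_splits)
qed

lemma step_class: "step g \<in> qf_class f \<longleftrightarrow> g \<in> qf_class f"
  by (simp add: step_def qf_class_opA qf_class_opB)

lemma funpow_step_class: "(step ^^ i) g \<in> qf_class f \<longleftrightarrow> g \<in> qf_class f"
  by (induction i) (auto simp: step_class)

lemma step_periodic:
  assumes "f \<in> H0_forms D"
  obtains p where "p > 0" "(step ^^ p) f = f"
proof -
  have "finite (range (\<lambda>i. (step ^^ i) f))"
    by (rule finite_subset[OF _ finite_H0_forms[of D]]) (use H0_funpow_step[OF assms] in blast)
  then have "\<not> inj (\<lambda>i. (step ^^ i) f)"
    using finite_imageD infinite_UNIV_nat by blast
  then obtain i j where ij: "i < j" "(step ^^ i) f = (step ^^ j) f"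
    using linorder_injI[of "\<lambda>i. (step ^^ i) f"] by blast
  have "(step ^^ (j - i)) f = f"
    using ij
  proof (induction i arbitrary: j)
    case (Suc i)
    from Suc.prems have "step ((step ^^ i) f) = step ((step ^^ (j - 1)) f)"
      by (cases j) auto
    then have "(step ^^ i) f = (step ^^ (j - 1)) f"
      using step_inj H0_funpow_step[OF assms] by (auto dest: inj_onD)
    from Suc.IH[OF _ this] Suc.prems show ?case by (cases j) auto
  qed simp
  then show thesis using that[of "j - i"] ij(1) by simp
qed

lemma merge_translate:
  assumes "qf_disc f = D"
  shows "merge (xi_plus (qf_subst 1 q 0 1 f)) (xi_plus f)"
proof -
  have shift: "merge (xi_plus (qf_subst 1 (int q) 0 1 f)) (xi_plus f)" if "qf_disc f = D" for f q
  proof (induction q)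
    case 0
    then show ?case by (simp add: merge_refl)
  next
    case (Suc q)
    let ?g = "qf_subst 1 (int q) 0 1 f"
    have d: "qf_disc ?g = D" using that by (simp add: qf_disc_subst)
    have "qf_subst 1 (int (Suc q)) 0 1 f = opA ?g"
      by (simp add: opA_subst qf_subst_qf_subst add.commute)
    then have "merge (xi_plus (qf_subst 1 (int (Suc q)) 0 1 f)) (xi_plus ?g)"
      using merge_shift[OF xi_irrat[OF d]] by (simp add: xi_opA[OF d])
    then show ?case using Suc merge_trans by blast
  qed
  show ?thesis
  proof (cases "q \<ge> 0")
    case True
    then show ?thesis using shift[OF assms, of "nat q"] by simp
  next
    case False
    let ?g = "qf_subst 1 q 0 1 f"
    have "qf_disc ?g = D" using assms by (simp add: qf_disc_subst)
    from shift[OF this, of "nat (- q)"] False have "merge (xi_plus (qf_subst 1 (- q) 0 1 ?g)) (xi_plus ?g)"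
      by simp
    then show ?thesis
      by (simp add: qf_subst_qf_subst merge_sym)
  qed
qed

text \<open>The Euclidean algorithm on the first column writes the matrix as a product of translations and of the
rotation by a quarter turn, which act on the root as \<open>x \<mapsto> x - q\<close> and \<open>x \<mapsto> - 1 / x\<close>.\<close>

lemma merge_subst:
  assumes "qf_disc f = D" "a * d - b * c = 1"
  shows "merge (xi_plus (qf_subst a b c d f)) (xi_plus f)"
  using assms
proof (induction "nat \<bar>c\<bar>" arbitrary: a b c d f rule: less_induct)
  case less
  show ?case
  proof (cases "c = 0")
    case True
    then have "a * d = 1" using less.prems by simp
    then consider "a = 1" "d = 1" | "a = - 1" "d = - 1"
      by (metis zmult_eq_1_iff)
    then have "qf_subst a b c d f = qf_subst 1 (a * b) 0 1 f"
      using True by cases (cases f; simp)+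
    then show ?thesis using merge_translate[OF less.prems(1)] by simp
  next
    case False
    define q where "q = a div c"
    let ?g = "qf_subst 1 q 0 1 f"
    have d: "qf_disc ?g = D" "qf_disc (qf_S ?g) = D"
      using less.prems by (simp_all add: qf_disc_subst)
    have lt: "nat \<bar>a - q * c\<bar> < nat \<bar>c\<bar>"
      using False abs_mod_less[of c a] by (simp add: q_def minus_div_mult_eq_mod)
    have "merge (xi_plus (qf_subst (- c) (- d) (a - q * c) (b - q * d) (qf_S ?g))) (xi_plus (qf_S ?g))"
      using less.prems(2) by (intro less.hyps[OF lt d(2)]) (simp add: algebra_simps)
    also have "qf_subst (- c) (- d) (a - q * c) (b - q * d) (qf_S ?g) = qf_subst a b c d f"
      by (simp add: qf_S_def qf_subst_qf_subst)
    finally show ?thesis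
      using merge_neg_inverse[OF xi_irrat[OF d(1)]] merge_translate[OF less.prems(1), of q]
        xi_S[OF d(1)] merge_trans by metis
  qed
qed

lemma merge_class:
  assumes "qf_disc f = D" "g \<in> qf_class f"
  shows "merge (xi_plus g) (xi_plus f)"
proof -
  obtain a b c d where "g = qf_subst a b c d f" "a * d - b * c = 1"
    using assms by (auto simp: qf_class_def)
  then show ?thesis using merge_subst[OF assms(1)] by blast
qed

text \<open>Reduction: if \<open>m\<close> and \<open>n\<close> have the same sign, then the one of smaller absolute value, \<open>x\<close>, satisfies
\<open>4 * x\<^sup>2 \<le> 4 * m * n < k\<^sup>2\<close>, so adding or subtracting \<open>2 * x\<close> lowers \<open>\<bar>k\<bar>\<close>. A class element with
\<open>m < 0 < n\<close> is turned by \<open>qf_S\<close>.\<close>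

lemma H0_in_class:
  assumes "qf_disc f = D"
  shows "\<exists>g \<in> qf_class f. g \<in> H0_forms D"
  using assms
proof (induction "nat \<bar>snd (snd f)\<bar>" arbitrary: f rule: less_induct)
  case less
  obtain m n k where f: "f = (m, n, k)" by (cases f)
  have d: "k^2 - 4 * m * n = D" using less.prems f by simp
  have nz: "m \<noteq> 0" "n \<noteq> 0" using coeffs_nonzero less.prems f by blast+
  have reduce: ?case if "g \<in> qf_class f" "\<bar>snd (snd g)\<bar> < \<bar>k\<bar>" for g
  proof -
    have "qf_disc g = D"
      using qf_class_disc[OF that(1)] less.prems by simp
    moreover have "nat \<bar>snd (snd g)\<bar> < nat \<bar>snd (snd f)\<bar>"
      using that(2) by (simp add: f)
    ultimately obtain h where "h \<in> qf_class g" "h \<in> H0_forms D"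
      using less.hyps[of g] by blast
    then show ?thesis using that(1) qf_class_trans by blast
  qed
  consider "m > 0" "n < 0" | "m < 0" "n > 0" | "m * n > 0"
    using nz by (auto simp: zero_less_mult_iff linorder_neq_iff)
  then show ?case
  proof cases
    case 1
    then show ?thesis
      using less.prems qf_class_refl[of f] by (auto simp: f H0_forms_def)
  next
    case 2
    then have "qf_S f \<in> H0_forms D" using d by (simp add: f H0_forms_def algebra_simps)
    then show ?thesis using qf_class_S qf_class_refl by blast
  next
    case 3
    then have "\<bar>m\<bar> * \<bar>n\<bar> = m * n" by (simp flip: abs_mult)
    have small: "\<bar>x\<bar> < \<bar>k\<bar> \<and> x \<noteq> 0" if "x = m \<and> \<bar>m\<bar> \<le> \<bar>n\<bar> \<or> x = n \<and> \<bar>n\<bar> \<le> \<bar>m\<bar>" for x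
    proof -
      have "\<bar>x\<bar> \<le> \<bar>m\<bar>" "\<bar>x\<bar> \<le> \<bar>n\<bar>" using that by auto
      then have "\<bar>x\<bar> * \<bar>x\<bar> \<le> \<bar>m\<bar> * \<bar>n\<bar>"
        by (rule mult_mono) auto
      then have "x^2 < k^2"
        using d D_pos 3 \<open>\<bar>m\<bar> * \<bar>n\<bar> = m * n\<close> by (simp add: power2_eq_square)
      then have "\<bar>x\<bar> < \<bar>k\<bar>" by (metis abs_le_square_iff not_le)
      then show ?thesis using that nz by blast
    qed
    have red: "\<bar>k + 2 * x\<bar> < \<bar>k\<bar> \<or> \<bar>k - 2 * x\<bar> < \<bar>k\<bar>" if "\<bar>x\<bar> < \<bar>k\<bar> \<and> x \<noteq> 0" for x
      using that by linarith
    have cl: "qf_subst 1 1 0 1 f \<in> qf_class f" "qf_subst 1 (- 1) 0 1 f \<in> qf_class f"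
      "qf_subst 1 0 1 1 f \<in> qf_class f" "qf_subst 1 0 (- 1) 1 f \<in> qf_class f"
      by (intro qf_class_subst qf_class_refl; simp)+
    have k: "snd (snd (qf_subst 1 1 0 1 f)) = k + 2 * m" "snd (snd (qf_subst 1 (- 1) 0 1 f)) = k - 2 * m"
      "snd (snd (qf_subst 1 0 1 1 f)) = k + 2 * n" "snd (snd (qf_subst 1 0 (- 1) 1 f)) = k - 2 * n"
      by (simp_all add: f)
    note red = red[THEN disjE]
    show ?thesis
    proof (cases "\<bar>m\<bar> \<le> \<bar>n\<bar>")
      case True
      show ?thesis
        using red[OF small[of m]] reduce[OF cl(1), unfolded k] reduce[OF cl(2), unfolded k] True by blast
    next
      case False
      then have "\<bar>n\<bar> \<le> \<bar>m\<bar>" by simp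
      then show ?thesis
        using red[OF small[of n]] reduce[OF cl(3), unfolded k] reduce[OF cl(4), unfolded k] by blast
    qed
  qed
qed

text \<open>The roots of two points have a common tail, hence so do their orbits under \<open>step\<close>; as both orbits are purely
periodic, they coincide.\<close>

lemma class_merge:
  assumes "qf_disc f = D" "g \<in> qf_class f" "h \<in> qf_class f"
    "g \<in> H0_forms D" "h \<in> H0_forms D"
  shows "\<exists>i. h = (step ^^ i) g"
proof -
  have "merge (xi_plus h) (xi_plus g)"
    using merge_class[OF assms(1)] assms(2,3) merge_sym merge_trans by blast
  then obtain i j where "(slow ^^ i) (xi_plus h) = (slow ^^ j) (xi_plus g)"
    by (auto simp: merge_def)
  then have e: "(step ^^ i) h = (step ^^ j) g"
    using H0_funpow_step[OF assms(4), of j] H0_funpow_step[OF assms(5), of i]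
    by (intro xi_inj) (auto simp: H0_disc)
  obtain p where p: "p > 0" "(step ^^ p) h = h"
    using step_periodic assms(5) by blast
  have "(step ^^ (p * i)) h = h"
    by (induction i) (auto simp: funpow_add p)
  moreover have "p * i = (p * i - i) + i" using p by simp
  ultimately have "h = (step ^^ (p * i - i)) ((step ^^ i) h)"
    by (metis comp_apply funpow_add)
  also have "\<dots> = (step ^^ (p * i - i + j)) g" by (simp add: e funpow_add)
  finally show ?thesis by blast
qed

end

section \<open>Points in the domains as points of the first domain\<close>

text \<open>Domains are compared by bijections of the set of all forms, such as \<open>opA\<close> and \<open>opB\<close>, that preserve the class.\<close>

lemma card_class_transport:
  assumes "bij \<sigma>" "\<And>g. \<sigma> g \<in> C \<longleftrightarrow> g \<in> C" "\<And>g. g \<in> C \<Longrightarrow> P (\<sigma> g) \<longleftrightarrow> Q g"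
  shows "card {g \<in> C. P g} = card {g \<in> C. Q g}"
proof -
  have "{g \<in> C. P g} = \<sigma> ` {g \<in> C. Q g}"
  proof
    show "{g \<in> C. P g} \<subseteq> \<sigma> ` {g \<in> C. Q g}"
    proof
      fix g assume g: "g \<in> {g \<in> C. P g}"
      obtain h where "g = \<sigma> h" using assms(1) by (metis bij_pointE)
      then show "g \<in> \<sigma> ` {g \<in> C. Q g}" using g assms(2,3) by blast
    qed
  qed (use assms(2,3) in blast)
  then show ?thesis
    by (simp add: card_image inj_on_subset[OF bij_is_inj[OF assms(1)] subset_UNIV])
qed

lemma real_qf_opA: "real_qf (opA g) = opA (real_qf g)"
  by (cases g) simp

lemma real_qf_opB: "real_qf (opB g) = opB (real_qf g)"
  by (cases g) simp

lemma card_points_opA: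
  "card (points_in (qf_class f) (opA ` H)) = card (points_in (qf_class f) H)"
  unfolding points_in_def
  by (rule card_class_transport[OF bij_opA qf_class_opA])
    (simp add: real_qf_opA inj_image_mem_iff[OF bij_is_inj[OF bij_opA]])

lemma card_points_opB:
  "card (points_in (qf_class f) (opB ` H)) = card (points_in (qf_class f) H)"
  unfolding points_in_def
  by (rule card_class_transport[OF bij_opB qf_class_opB])
    (simp add: real_qf_opB inj_image_mem_iff[OF bij_is_inj[OF bij_opB]])

lemma card_points_T_plus:
  assumes "T \<in> T_plus"
  shows "card (points_in (qf_class f) (T ` H)) = card (points_in (qf_class f) H)"
  using assms
proof induction
  case (T_plus_A T)
  then show ?case by (simp only: image_comp[symmetric] card_points_opA)
next
  case (T_plus_B T)
  then show ?case by (simp only: image_comp[symmetric] card_points_opB)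
qed simp

lemma card_points_T_minus:
  assumes "T \<in> T_minus"
  shows "card (points_in (qf_class f) (T ` H)) = card (points_in (qf_class f) H)"
  using assms
proof induction
  case T_minus_id
  then show ?case by simp
next
  case (T_minus_A T)
  have "opA ` ((inv opA \<circ> T) ` H) = T ` H"
    by (simp only: image_comp[symmetric] image_f_inv_f[OF bij_is_surj[OF bij_opA]])
  then show ?case using card_points_opA[of f "(inv opA \<circ> T) ` H"] T_minus_A by simp
next
  case (T_minus_B T)
  have "opB ` ((inv opB \<circ> T) ` H) = T ` H"
    by (simp only: image_comp[symmetric] image_f_inv_f[OF bij_is_surj[OF bij_opB]])
  then show ?case using card_points_opB[of f "(inv opB \<circ> T) ` H"] T_minus_B by simp
qed

lemma bij_qf_S: "bij qf_S"
  by (rule bij_betw_byWitness[where f' = "\<lambda>(m, n, k). (n, m, - k)"]) auto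

lemma qf_disc_real: "qf_disc (real_of_int m, real_of_int n, real_of_int k) = real_of_int (qf_disc (m, n, k))"
  by simp

context nonsquare_disc
begin

lemma class_disc:
  assumes "qf_disc f = D" "g \<in> qf_class f"
  shows "qf_disc g = D"
  using qf_class_disc[OF assms(2)] assms(1) by simp

lemma points_H0:
  assumes "qf_disc f = D"
  shows "points_in (qf_class f) (dom_H0 D) = {g \<in> qf_class f. g \<in> H0_forms D}"
  by (auto simp: points_in_def dom_H0_def H0_forms_def qf_disc_real simp del: qf_disc.simps)

lemma card_points_H0R:
  assumes "qf_disc f = D"
  shows "card (points_in (qf_class f) (dom_H0R D)) = card {g \<in> qf_class f. g \<in> H0_forms D}"
  unfolding points_in_def
proof (rule card_class_transport[OF bij_qf_S qf_class_S])
  fix g :: "int bqf"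
  obtain m n k where g: "g = (m, n, k)" by (cases g)
  show "real_qf (qf_S g) \<in> dom_H0R D \<longleftrightarrow> g \<in> H0_forms D"
    using qf_disc_ops(3)[of g] unfolding g
    by (auto simp: dom_H0R_def H0_forms_def qf_disc_real
        simp del: qf_disc.simps qf_disc_ops of_int_minus)
qed

text \<open>\<open>opA g\<close> lies in \<open>H\<^sub>A\<close> iff \<open>m > 0\<close>, \<open>m + n + k > 0\<close> and \<open>n < 0\<close>: the inequality between the sum of the outer
coefficients and the middle one reduces to \<open>n < 0\<close>.\<close>

lemma card_points_HA:
  assumes "qf_disc f = D"
  shows "card (points_in (qf_class f) (dom_HA D)) =
    card {g \<in> qf_class f. g \<in> H0_forms D \<and> qf_eval g 1 1 > 0}"
  unfolding points_in_def
proof (rule card_class_transport[OF bij_opA qf_class_opA])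
  fix g assume "g \<in> qf_class f"
  then have d: "qf_disc g = D" "qf_disc (opA g) = D" using class_disc[OF assms] by simp_all
  obtain m n k where g: "g = (m, n, k)" by (cases g)
  show "real_qf (opA g) \<in> dom_HA D \<longleftrightarrow> g \<in> H0_forms D \<and> qf_eval g 1 1 > 0"
    using d unfolding g by (auto simp: dom_HA_def H0_forms_def qf_disc_real
      simp del: qf_disc.simps of_int_add of_int_mult simp flip: of_int_add)
qed

lemma card_points_HB:
  assumes "qf_disc f = D"
  shows "card (points_in (qf_class f) (dom_HB D)) =
    card {g \<in> qf_class f. g \<in> H0_forms D \<and> \<not> qf_eval g 1 1 > 0}"
  unfolding points_in_def
proof (rule card_class_transport[OF bij_opB qf_class_opB])
  fix g assume "g \<in> qf_class f"
  then have d: "qf_disc g = D" "qf_disc (opB g) = D" using class_disc[OF assms] by simp_all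
  obtain m n k where g: "g = (m, n, k)" by (cases g)
  have "m + n + k \<noteq> 0" using coeffs_nonzero d g by blast
  then show "real_qf (opB g) \<in> dom_HB D \<longleftrightarrow> g \<in> H0_forms D \<and> \<not> qf_eval g 1 1 > 0"
    using d unfolding g by (auto simp: dom_HB_def H0_forms_def qf_disc_real
      simp del: qf_disc.simps of_int_add of_int_mult simp flip: of_int_add)
qed

text \<open>Here \<open>opA\<close> maps the domain onto the part of \<open>H0\<close> that is reached by a step with \<open>opB\<close>, and this part has as
many points in the class as the part from which such a step starts.\<close>

lemma card_points_HAbar:
  assumes "qf_disc f = D"
  shows "card (points_in (qf_class f) (dom_HAbar D)) =
    card {g \<in> qf_class f. g \<in> H0_forms D \<and> qf_eval g 1 1 > 0}"
proof -
  have "card {g \<in> qf_class f. g \<in> H0_forms D \<and> qf_eval g 1 (- 1) > 0} =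
    card {g \<in> qf_class f. real_qf g \<in> dom_HAbar D}"
  proof (rule card_class_transport[OF bij_opA qf_class_opA])
    fix g assume "g \<in> qf_class f"
    then have d: "qf_disc g = D" "qf_disc (opA g) = D" using class_disc[OF assms] by simp_all
    obtain m n k where g: "g = (m, n, k)" by (cases g)
    show "opA g \<in> H0_forms D \<and> qf_eval (opA g) 1 (- 1) > 0 \<longleftrightarrow> real_qf g \<in> dom_HAbar D"
      using d unfolding g by (auto simp: dom_HAbar_def H0_forms_def qf_disc_real
        simp del: qf_disc.simps of_int_add of_int_minus simp flip: of_int_add of_int_minus)
  qed
  moreover have "card {g \<in> qf_class f. g \<in> H0_forms D \<and> qf_eval g 1 (- 1) > 0} =
    card {g \<in> qf_class f. g \<in> H0_forms D \<and> qf_eval g 1 1 > 0}"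
  proof (rule card_class_transport[OF bij_opB qf_class_opB])
    fix g assume "g \<in> qf_class f"
    then have d: "qf_disc g = D" "qf_disc (opB g) = D" using class_disc[OF assms] by simp_all
    obtain m n k where g: "g = (m, n, k)" by (cases g)
    show "opB g \<in> H0_forms D \<and> qf_eval (opB g) 1 (- 1) > 0 \<longleftrightarrow>
        g \<in> H0_forms D \<and> qf_eval g 1 1 > 0"
      using d unfolding g by (auto simp: H0_forms_def simp del: qf_disc.simps)
  qed
  ultimately show ?thesis by (simp add: points_in_def)
qed

text \<open>As for the conjugate of \<open>H\<^sub>A\<close>, with the two operators exchanged.\<close>

lemma card_points_HBbar:
  assumes "qf_disc f = D"
  shows "card (points_in (qf_class f) (dom_HBbar D)) =
    card {g \<in> qf_class f. g \<in> H0_forms D \<and> \<not> qf_eval g 1 1 > 0}"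
proof -
  have "card {g \<in> qf_class f. g \<in> H0_forms D \<and> qf_eval g 1 (- 1) < 0} =
    card {g \<in> qf_class f. real_qf g \<in> dom_HBbar D}"
  proof (rule card_class_transport[OF bij_opB qf_class_opB])
    fix g assume "g \<in> qf_class f"
    then have d: "qf_disc g = D" "qf_disc (opB g) = D" using class_disc[OF assms] by simp_all
    obtain m n k where g: "g = (m, n, k)" by (cases g)
    show "opB g \<in> H0_forms D \<and> qf_eval (opB g) 1 (- 1) < 0 \<longleftrightarrow> real_qf g \<in> dom_HBbar D"
      using d unfolding g by (auto simp: dom_HBbar_def H0_forms_def qf_disc_real
        simp del: qf_disc.simps of_int_add of_int_minus simp flip: of_int_add of_int_minus)
  qed
  moreover have "card {g \<in> qf_class f. g \<in> H0_forms D \<and> qf_eval g 1 (- 1) < 0} =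
    card {g \<in> qf_class f. g \<in> H0_forms D \<and> \<not> qf_eval g 1 1 > 0}"
  proof (rule card_class_transport[OF bij_opA qf_class_opA])
    fix g assume "g \<in> qf_class f"
    then have d: "qf_disc g = D" "qf_disc (opA g) = D" using class_disc[OF assms] by simp_all
    obtain m n k where g: "g = (m, n, k)" by (cases g)
    have "m + n + k \<noteq> 0" using coeffs_nonzero d g by blast
    then show "opA g \<in> H0_forms D \<and> qf_eval (opA g) 1 (- 1) < 0 \<longleftrightarrow>
        g \<in> H0_forms D \<and> \<not> qf_eval g 1 1 > 0"
      using d unfolding g by (auto simp: H0_forms_def simp del: qf_disc.simps)
  qed
  ultimately show ?thesis by (simp add: points_in_def)
qed

end

section \<open>Symmetries of a class\<close>

text \<open>An involution that normalises the action permutes the classes, so it preserves a class as soon as it sends one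
of its points into it.\<close>

lemma qf_class_image:
  assumes "\<And>a b c d g. \<iota> (qf_subst a b c d g) = qf_subst (\<alpha> a b c d) (\<beta> a b c d) (\<gamma> a b c d) (\<delta> a b c d) (\<iota> g)"
    and "\<And>a b c d. a * d - b * c = 1 \<Longrightarrow> \<alpha> a b c d * \<delta> a b c d - \<beta> a b c d * \<gamma> a b c d = 1"
    and invol: "\<And>g. \<iota> (\<iota> g) = g"
    and "g \<in> qf_class f"
  shows "\<iota> ` qf_class f = qf_class f \<longleftrightarrow> \<iota> g \<in> qf_class f"
proof
  assume "\<iota> ` qf_class f = qf_class f"
  then show "\<iota> g \<in> qf_class f" using assms(4) by blast
next
  assume g: "\<iota> g \<in> qf_class f"
  have sub: "\<iota> h \<in> qf_class f" if "h \<in> qf_class f" for h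
  proof -
    have "h \<in> qf_class g" using that assms(4) qf_class_eq by blast
    then obtain a b c d where h: "h = qf_subst a b c d g" and det: "a * d - b * c = 1"
      by (auto simp: qf_class_def)
    show ?thesis
      unfolding h assms(1) using qf_class_subst[OF g assms(2)[OF det]] .
  qed
  show "\<iota> ` qf_class f = qf_class f"
  proof
    show "qf_class f \<subseteq> \<iota> ` qf_class f"
    proof
      fix h assume "h \<in> qf_class f"
      then show "h \<in> \<iota> ` qf_class f" using sub[of h] invol[of h] by (metis imageI)
    qed
  qed (use sub in blast)
qed

lemma anti_invariant_iff:
  assumes "g \<in> qf_class f"
  shows "qf_anti ` qf_class f = qf_class f \<longleftrightarrow> qf_anti g \<in> qf_class f"
proof (rule qf_class_image[OF _ _ _ assms])
  show "qf_anti (qf_subst a b c d g) = qf_subst d c b a (qf_anti g)" for a b c d g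
    by (cases g) (simp add: algebra_simps)
  show "qf_anti (qf_anti g) = g" for g by (cases g) simp
qed (simp add: algebra_simps)

lemma adj_invariant_iff:
  assumes "g \<in> qf_class f"
  shows "qf_adj ` qf_class f = qf_class f \<longleftrightarrow> qf_adj g \<in> qf_class f"
proof (rule qf_class_image[OF _ _ _ assms])
  show "qf_adj (qf_subst a b c d g) = qf_subst d (- c) (- b) a (qf_adj g)" for a b c d g
    by (cases g) (simp add: algebra_simps)
  show "qf_adj (qf_adj g) = g" for g by (cases g) simp
qed (simp add: algebra_simps)

text \<open>Each of the three involutions is the product of the other two, so two of them preserve the class only if
all three do. The classes left out are those with no symmetry and those with conjugation only.\<close>

lemma symmetry_types_iff:
  "supersymmetric C \<or> antisymmetric C \<or> mn_symmetric C \<longleftrightarrow>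
    qf_adj ` C = C \<or> qf_anti ` C = C"
proof -
  have 1: "qf_conj ` C = qf_adj ` qf_anti ` C"
    unfolding image_image by (rule image_cong) (auto split: prod.splits)
  have 2: "qf_anti ` C = qf_conj ` qf_adj ` C"
    unfolding image_image by (rule image_cong) (auto split: prod.splits)
  have 3: "qf_adj ` C = qf_conj ` qf_anti ` C"
    unfolding image_image by (rule image_cong) (auto split: prod.splits)
  show ?thesis
    unfolding supersymmetric_def antisymmetric_def mn_symmetric_def using 1 2 3 by metis
qed

section \<open>The cycle of a class\<close>

lemma qf_adj_adj [simp]: "qf_adj (qf_adj g) = g"
  by (cases g) simp

lemma H0_anti: "qf_anti g \<in> H0_forms D \<longleftrightarrow> g \<in> H0_forms D"
  by (cases g) (auto simp: H0_forms_def algebra_simps)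

lemma H0_adj: "qf_adj g \<in> H0_forms D \<longleftrightarrow> g \<in> H0_forms D"
  by (cases g) (auto simp: H0_forms_def algebra_simps)

context nonsquare_disc
begin

text \<open>The adjoint conjugates each step into the inverse of the step with the other operator.\<close>

lemma adj_step:
  assumes "g \<in> H0_forms D"
  shows "step (qf_adj (step g)) = qf_adj g"
    and "xi_plus (qf_adj (step g)) > 1 \<longleftrightarrow> \<not> xi_plus g > 1"
proof -
  have "step (qf_adj (step g)) = qf_adj g \<and>
    (qf_eval (qf_adj (step g)) 1 1 > 0 \<longleftrightarrow> \<not> qf_eval g 1 1 > 0)"
    using assms by (cases g) (auto simp: step_def H0_forms_def)
  then show "step (qf_adj (step g)) = qf_adj g"
    "xi_plus (qf_adj (step g)) > 1 \<longleftrightarrow> \<not> xi_plus g > 1"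
    using H0_xi(2)[OF assms] H0_xi(2)[of "qf_adj (step g)"] H0_step(1)[OF assms]
    by (simp_all only: H0_adj)
qed

lemma adj_funpow_step:
  assumes "g \<in> H0_forms D"
  shows "(step ^^ n) (qf_adj ((step ^^ n) g)) = qf_adj g \<and>
    itin n (xi_plus (qf_adj ((step ^^ n) g))) = map Not (rev (itin n (xi_plus g)))"
proof (induction n)
  case 0
  then show ?case by (simp add: itin_def)
next
  case (Suc n)
  let ?h = "(step ^^ n) g"
  have h: "?h \<in> H0_forms D" "xi_plus ?h = (slow ^^ n) (xi_plus g)"
    using H0_funpow_step[OF assms] by blast+
  have a: "qf_adj (step ?h) \<in> H0_forms D"
    using H0_step(1)[OF h(1)] by (simp only: H0_adj)
  have s: "slow (xi_plus (qf_adj (step ?h))) = xi_plus (qf_adj ?h)"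
    using H0_step(2)[OF a] by (simp only: adj_step(1)[OF h(1)])
  have "itin (Suc n) (xi_plus g) = itin n (xi_plus g) @ [xi_plus ?h > 1]"
    using h(2) by (simp add: itin_def)
  then have "itin (Suc n) (xi_plus (qf_adj (step ?h))) = map Not (rev (itin (Suc n) (xi_plus g)))"
    using Suc by (simp only: itin_Suc[of n "xi_plus (qf_adj (step ?h))"] s adj_step(2)[OF h(1)]
        rev_append list.map append_Cons append_Nil rev.simps conjunct2)
  moreover have "(step ^^ Suc n) (qf_adj (step ?h)) = qf_adj g"
    using Suc by (simp only: funpow_Suc_right comp_apply adj_step(1)[OF h(1)])
  ultimately show ?case by simp
qed

end

text \<open>A class together with a purely periodic number \<open>y > 1\<close> in the common tail of its roots. Minimality is imposed
on the Gauss orbit of \<open>y\<close>, because returns of the cycle appear as equations between numbers and not between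
sequences of partial quotients.\<close>

locale class_period = nonsquare_disc +
  fixes f :: "int bqf" and y :: real and l :: "nat list"
  assumes disc: "qf_disc f = D"
    and y: "y \<in> pos_irrat" "y > 1" "merge y (xi_plus f)"
    and l: "l \<noteq> []" "0 \<notin> set l" "\<And>i. cf_quot y i = int (l ! (i mod length l))"
    and minimal: "\<And>j. j > 0 \<Longrightarrow> (gauss ^^ j) y = y \<Longrightarrow> length l \<le> j"
begin

text \<open>The orbit of \<open>y\<close> runs into that of a root of a form in \<open>H0\<close>.\<close>

lemma slow_eventually_periodic:
  obtains g j where "g \<in> qf_class f" "g \<in> H0_forms D" "(slow ^^ j) y = xi_plus g"
proof -
  obtain g where g: "g \<in> qf_class f" "g \<in> H0_forms D"
    using H0_in_class[OF disc] by blast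
  have "merge y (xi_plus g)"
    using merge_class[OF disc g(1)] y(3) merge_sym merge_trans by blast
  then obtain i j where "(slow ^^ j) y = (slow ^^ i) (xi_plus g)"
    by (auto simp: merge_def)
  then show thesis
    using that[of "(step ^^ i) g"] g H0_funpow_step[OF g(2), of i] funpow_step_class by metis
qed

text \<open>\<open>y\<close> and its \<open>length l\<close>-th Gauss iterate have the same partial quotients, hence the same itinerary, and both
are eventually periodic because \<open>y\<close> is.\<close>

lemma gauss_period: "(gauss ^^ length l) y = y"
proof -
  let ?P = "length l"
  define z where "z = (gauss ^^ ?P) y"
  have z: "z \<in> pos_irrat" using y by (simp add: z_def pos_irrat_funpow_gauss)
  have cf: "cf_quot y i = cf_quot z i" for i
  proof -
    have "cf_quot z i = cf_quot y (i + ?P)" by (simp add: z_def cf_quot_gauss funpow_add)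
    then show ?thesis by (simp add: l(3))
  qed
  obtain g j where g: "g \<in> H0_forms D" "(slow ^^ j) y = xi_plus g"
    using slow_eventually_periodic by metis
  obtain p where p: "p > 0" "(step ^^ p) g = g" using step_periodic[OF g(1)] by blast
  have per: "(slow ^^ p) ((slow ^^ j) y) = (slow ^^ j) y"
    using H0_funpow_step[OF g(1), of p] p g(2) by simp
  let ?S = "sum_list l"
  have "cf_quot y i = int (l ! i)" if "i < length l" for i
    using that l(3)[of i] by simp
  from itin_cf_prefix[OF y(1) this]
  have S: "(slow ^^ ?S) y = (if even ?P then z else 1 / z)"
    unfolding z_def by blast
  have "(slow ^^ p) ((slow ^^ j) ((slow ^^ ?S) y)) = (slow ^^ ?S) ((slow ^^ p) ((slow ^^ j) y))"
    by (metis add.commute comp_apply funpow_add)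
  also have "\<dots> = (slow ^^ j) ((slow ^^ ?S) y)"
    unfolding per by (metis add.commute comp_apply funpow_add)
  finally have "(slow ^^ p) ((slow ^^ j) z) = (slow ^^ j) z"
    unfolding S by (auto simp: funpow_slow_inverse z pos_irrat_funpow_slow split: if_splits)
  then have "y = z"
    using itinerary_determines[OF y(1) z same_cf_same_letters[OF y(1,2) z cf] per] p(1) by blast
  then show ?thesis by (simp add: z_def)
qed

lemma gauss_period_iff: "(gauss ^^ j) y = y \<longleftrightarrow> length l dvd j"
proof
  assume "length l dvd j"
  then have "j mod length l = 0" by simp
  then show "(gauss ^^ j) y = y"
    using funpow_mod_eq[where f = gauss and m = j, OF gauss_period] by simp
next
  assume "(gauss ^^ j) y = y"
  then have "(gauss ^^ (j mod length l)) y = y"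
    using funpow_mod_eq[where f = gauss and m = j, OF gauss_period] by simp
  moreover have "j mod length l < length l" using l(1) by simp
  ultimately have "j mod length l = 0" using minimal[of "j mod length l"] by linarith
  then show "length l dvd j" by auto
qed

abbreviation (input) L where "L \<equiv> even_period l"
abbreviation (input) T where "T \<equiv> sum_list L"

lemma L: "L \<noteq> []" "0 \<notin> set L" "even (length L)" "length l dvd length L"
    "cf_quot y i = int (L ! (i mod length L))"
proof -
  have "L ! (i mod length L) = l ! (i mod length l)"
  proof (cases "odd (length l)")
    case True
    have "i mod (2 * length l) mod length l = i mod length l"
      by (simp add: mod_mod_cancel)
    moreover have "i mod (2 * length l) < 2 * length l" using l(1) by simp
    ultimately have "(l @ l) ! (i mod (2 * length l)) = l ! (i mod length l)"
      by (auto simp: nth_append mod_if[of "i mod (2 * length l)" "length l"])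
    then show ?thesis using True by (simp add: even_period_def mult_2)
  qed (simp add: even_period_def)
  then show "cf_quot y i = int (L ! (i mod length L))" by (simp add: l(3))
qed (use l in \<open>auto simp: even_period_def\<close>)

lemma T_pos: "T > 0"
  using L(1,2) by (cases L) auto

lemma even_period_dvd: "even j \<Longrightarrow> length l dvd j \<Longrightarrow> length L dvd j"
  by (auto simp: even_period_def mult_2[symmetric] intro: divides_mult)

lemma slow_cycle: "(slow ^^ T) y = y" "itin T y = runs L"
proof -
  have "cf_quot y i = int (L ! i)" if "i < length L" for i
    using that L(5)[of i] by simp
  note itin_cf_prefix[OF y(1) this]
  then show "(slow ^^ T) y = y" "itin T y = runs L"
    using L(3,4) gauss_period_iff[of "length L"] by auto
qed

text \<open>The word of one turn has an even number of runs, so it ends in a run of \<open>False\<close>.\<close>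

lemma last_letter: "\<not> (slow ^^ (T - 1)) y > 1"
proof -
  have "itin T y \<noteq> []"
    using T_pos length_itin[of T y] by (metis length_0_conv less_irrefl)
  then have "last (itin T y) = itin T y ! (T - 1)"
    by (metis last_conv_nth length_itin)
  also have "\<dots> = ((slow ^^ (T - 1)) y > 1)"
    using T_pos by (intro nth_itin) linarith
  finally have "last (runs L) = ((slow ^^ (T - 1)) y > 1)"
    by (simp only: slow_cycle)
  then show ?thesis using runs_last[OF L(1-3)] by simp
qed

text \<open>A return to \<open>y\<close> after \<open>u\<close> steps is preceded by the letter \<open>False\<close>, as every return to \<open>y\<close> is, and followed by \<open>True\<close>. So
it occurs after an even number \<open>j\<close> of complete runs, and \<open>y\<close> is fixed by \<open>j\<close> steps of the Gauss map.\<close>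

lemma slow_cycle_minimal:
  assumes "0 < u" "(slow ^^ u) y = y"
  shows "T \<le> u"
proof -
  obtain v where u: "u = Suc v" using assms(1) by (cases u) auto
  have "(slow ^^ (T - 1)) y = (slow ^^ (T - 1)) ((slow ^^ u) y)" by (simp only: assms(2))
  also have "\<dots> = (slow ^^ (T - 1 + u)) y" by (simp only: funpow_add comp_apply)
  also have "T - 1 + u = v + T" using u T_pos by simp
  also have "(slow ^^ (v + T)) y = (slow ^^ v) y" by (simp only: funpow_add comp_apply slow_cycle)
  finally have "\<not> (slow ^^ v) y > 1" using last_letter by simp
  moreover have "(slow ^^ Suc v) y > 1" using assms(2) y(2) u by simp
  ultimately obtain j where j: "even j" "int u = (\<Sum>i<j. cf_quot y i)" "y = (gauss ^^ j) y"
    using slow_turn[OF y(1,2), of v] assms(2) unfolding u by metis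
  have "length L dvd j" using gauss_period_iff[of j] j(1,3) even_period_dvd by metis
  moreover have "j > 0" using j(2) assms(1) by (cases j) auto
  ultimately have le: "length L \<le> j" by (rule dvd_imp_le)
  have "int T = (\<Sum>i<length L. int (L ! i))"
    by (simp add: sum_list_sum_nth atLeast0LessThan)
  also have "\<dots> = (\<Sum>i<length L. cf_quot y i)"
    by (rule sum.cong) (simp_all add: L(5))
  also have "\<dots> \<le> (\<Sum>i<j. cf_quot y i)"
    using le by (intro sum_mono2) (auto simp: l(3))
  finally show ?thesis using j(2) by simp
qed

text \<open>Since \<open>y\<close> is periodic, it lies on every orbit that it runs into.\<close>

lemma y_form: "\<exists>g. g \<in> qf_class f \<and> g \<in> H0_forms D \<and> xi_plus g = y"
proof -
  obtain h j where h: "h \<in> qf_class f" "h \<in> H0_forms D" "(slow ^^ j) y = xi_plus h"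
    using slow_eventually_periodic by metis
  let ?i = "T * j - j"
  have "T * j \<ge> j" using T_pos by simp
  then have "(slow ^^ ?i) (xi_plus h) = (slow ^^ (T * j)) y"
    by (metis comp_apply funpow_add h(3) le_add_diff_inverse2)
  also have "(slow ^^ (T * j)) y = y"
    using funpow_mod_eq[where f = slow and m = "T * j", OF slow_cycle(1)] by simp
  finally show ?thesis
    using h H0_funpow_step[OF h(2), of ?i] funpow_step_class[of ?i h f] by metis
qed

definition g where "g = (SOME g. g \<in> qf_class f \<and> g \<in> H0_forms D \<and> xi_plus g = y)"

lemma g: "g \<in> qf_class f" "g \<in> H0_forms D" "xi_plus g = y"
  using someI_ex[OF y_form] unfolding g_def by auto

lemma xi_cycle: "xi_plus ((step ^^ u) g) = (slow ^^ u) y"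
  using H0_funpow_step[OF g(2)] g(3) by simp

lemma H0_cycle: "(step ^^ u) g \<in> H0_forms D" "(step ^^ u) g \<in> qf_class f"
  using H0_funpow_step[OF g(2)] g(1) funpow_step_class by blast+

lemma step_cycle: "(step ^^ T) g = g"
  using xi_cycle[of T] slow_cycle(1) g(3) H0_cycle(1) g(2) by (intro xi_inj) (auto simp: H0_disc)

lemma cycle_eqI:
  assumes "h \<in> H0_forms D" "xi_plus h = (slow ^^ u) y"
  shows "h = (step ^^ u) g"
  using assms H0_cycle(1)[of u] xi_cycle[of u] by (intro xi_inj) (auto simp: H0_disc)

lemma class_cycle:
  assumes "h \<in> qf_class f" "h \<in> H0_forms D"
  shows "\<exists>u. h = (step ^^ u) g"
  using class_merge[OF disc g(1) assms(1) g(2) assms(2)] .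

lemma H0_class_eq: "{h \<in> qf_class f. h \<in> H0_forms D} = (\<lambda>u. (step ^^ u) g) ` {..<T}"
proof
  show "{h \<in> qf_class f. h \<in> H0_forms D} \<subseteq> (\<lambda>u. (step ^^ u) g) ` {..<T}"
  proof
    fix h assume "h \<in> {h \<in> qf_class f. h \<in> H0_forms D}"
    then obtain u where "h = (step ^^ u) g" using class_cycle by blast
    also have "\<dots> = (step ^^ (u mod T)) g"
      by (rule funpow_mod_eq[symmetric]) (rule step_cycle)
    finally show "h \<in> (\<lambda>u. (step ^^ u) g) ` {..<T}" using T_pos by auto
  qed
qed (use H0_cycle in blast)

lemma inj_cycle: "inj_on (\<lambda>u. (step ^^ u) g) {..<T}"
proof (rule linorder_inj_onI)
  fix u v assume uv: "u < v" "u \<in> {..<T}" "v \<in> {..<T}"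
  show "(step ^^ u) g \<noteq> (step ^^ v) g"
  proof
    assume "(step ^^ u) g = (step ^^ v) g"
    then have e: "(slow ^^ u) y = (slow ^^ v) y" using xi_cycle by metis
    have "(slow ^^ (T - u + v)) y = (slow ^^ (T - u)) ((slow ^^ v) y)"
      by (simp only: funpow_add comp_apply)
    also have "\<dots> = (slow ^^ (T - u + u)) y" by (simp only: e[symmetric] funpow_add comp_apply)
    also have "\<dots> = y" using uv slow_cycle(1) by simp
    finally have "(slow ^^ (v - u + T)) y = y" using uv by (simp add: add.commute)
    then have "(slow ^^ (v - u)) y = y" by (simp only: funpow_add comp_apply slow_cycle)
    then have "T \<le> v - u" using uv by (intro slow_cycle_minimal) auto
    then show False using uv by auto
  qed
qed auto

lemma card_H0: "card {h \<in> qf_class f. h \<in> H0_forms D} = T"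
  unfolding H0_class_eq by (simp add: card_image inj_cycle)

text \<open>Going once around the cycle meets each point of the class in \<open>H0\<close> once and spells \<open>runs L\<close>.\<close>

lemma card_letter:
  "card {h \<in> qf_class f. h \<in> H0_forms D \<and> (xi_plus h > 1) = b} = count_list (runs L) b"
proof -
  have "{h \<in> qf_class f. h \<in> H0_forms D \<and> (xi_plus h > 1) = b} =
    (\<lambda>u. (step ^^ u) g) ` {u \<in> {..<T}. ((slow ^^ u) y > 1) = b}"
  proof -
    have "{h \<in> qf_class f. h \<in> H0_forms D \<and> (xi_plus h > 1) = b} =
      {h \<in> (\<lambda>u. (step ^^ u) g) ` {..<T}. (xi_plus h > 1) = b}"
      unfolding H0_class_eq[symmetric] by blast
    also have "\<dots> = (\<lambda>u. (step ^^ u) g) ` {u \<in> {..<T}. ((slow ^^ u) y > 1) = b}"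
      using xi_cycle by (auto simp del: xi_plus.simps)
    finally show ?thesis .
  qed
  then have "card {h \<in> qf_class f. h \<in> H0_forms D \<and> (xi_plus h > 1) = b} =
      card {u \<in> {..<T}. ((slow ^^ u) y > 1) = b}"
    by (simp only: card_image[OF inj_on_subset[OF inj_cycle Collect_subset]])
  also have "{u \<in> {..<T}. ((slow ^^ u) y > 1) = b} = {u. u < length (itin T y) \<and> b = itin T y ! u}"
    by (auto simp: nth_itin)
  also have "card \<dots> = count_list (itin T y) b"
    by (simp add: count_list_eq_length_filter length_filter_conv_card)
  finally show ?thesis by (simp add: slow_cycle)
qed

text \<open>For odd \<open>length l\<close>, spelling \<open>l\<close> once leads from \<open>y\<close> to \<open>1 / y\<close>, the root of the antipodal form. Conversely, if
\<open>1 / y\<close> is on the cycle, the letter changes from \<open>True\<close> to \<open>False\<close> there, so it is reached after an odd number \<open>j\<close> of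
runs, and \<open>length l\<close> divides \<open>j\<close>.\<close>

lemma anti_iff: "qf_anti g \<in> qf_class f \<longleftrightarrow> odd (length l)"
proof
  assume "odd (length l)"
  have "cf_quot y i = int (l ! i)" if "i < length l" for i
    using that l(3)[of i] by simp
  from itin_cf_prefix[OF y(1) this]
  have "(slow ^^ sum_list l) y = 1 / y"
    using \<open>odd (length l)\<close> gauss_period by simp
  moreover have "xi_plus (qf_anti g) = 1 / y"
    using xi_anti[OF H0_disc[OF g(2)]] g(3) by simp
  ultimately have "qf_anti g = (step ^^ sum_list l) g"
    using g(2) by (intro cycle_eqI) (simp_all only: H0_anti)
  then show "qf_anti g \<in> qf_class f" using H0_cycle by metis
next
  assume "qf_anti g \<in> qf_class f"
  moreover have "qf_anti g \<in> H0_forms D" using g(2) by (simp only: H0_anti)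
  ultimately obtain i where "qf_anti g = (step ^^ i) g" using class_cycle by blast
  then have i: "(slow ^^ i) y = 1 / y"
    using xi_anti[OF H0_disc[OF g(2)]] g(3) xi_cycle by metis
  define u where "u = T - 1 + i"
  have Suc_u: "Suc u = i + T" using T_pos by (simp add: u_def)
  have s: "(slow ^^ Suc u) y = 1 / y"
    unfolding Suc_u by (simp only: funpow_add comp_apply slow_cycle i)
  have "(slow ^^ u) y = 1 / (slow ^^ (T - 1)) y"
    unfolding u_def by (simp add: funpow_add i funpow_slow_inverse[OF y(1)])
  moreover have "(slow ^^ (T - 1)) y \<in> pos_irrat" using y(1) by (rule pos_irrat_funpow_slow)
  ultimately have "(slow ^^ u) y > 1"
    using last_letter pos_irrat_neq_1 by (simp add: pos_irrat_def) force
  moreover have n: "\<not> (slow ^^ Suc u) y > 1" unfolding s using y(2) by simp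
  ultimately obtain j where "odd j" "1 / y = 1 / (gauss ^^ j) y"
    using slow_turn[OF y(1,2), of u] s by metis
  then have "(gauss ^^ j) y = y" by simp
  then have "length l dvd j" using gauss_period_iff by blast
  then show "odd (length l)" using \<open>odd j\<close> dvd_trans by blast
qed

lemma slow_gauss_even:
  assumes "even j"
  shows "\<exists>u. (slow ^^ u) y = (gauss ^^ j) y"
proof -
  define w where "w = map (\<lambda>i. nat (cf_quot y i)) [0..<j]"
  have "cf_quot y i = int (w ! i)" if "i < length w" for i
    using that by (simp add: w_def l(3))
  from itin_cf_prefix[OF y(1) this] show ?thesis
    using assms by (auto simp: w_def)
qed

lemma itin_rotate: "itin T ((gauss ^^ j) y) = runs (rotate j L)"
proof -
  have z: "(gauss ^^ j) y \<in> pos_irrat" using y(1) by (rule pos_irrat_funpow_gauss)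
  have "cf_quot ((gauss ^^ j) y) i = int (rotate j L ! i)" if "i < length (rotate j L)" for i
  proof -
    have "cf_quot ((gauss ^^ j) y) i = cf_quot y (i + j)"
      by (simp add: cf_quot_gauss funpow_add)
    then show ?thesis using that by (simp add: L(5) nth_rotate add.commute)
  qed
  from itin_cf_prefix[OF z this] have "itin (sum_list (rotate j L)) ((gauss ^^ j) y) = runs (rotate j L)"
    by blast
  moreover have "sum_list (rotate j L) = T"
  proof (induction j)
    case (Suc j)
    then show ?case by (cases "rotate j L") (auto simp: rotate_Suc)
  qed simp
  ultimately show ?thesis by simp
qed

lemma itin_adj: "itin T (xi_plus (qf_adj g)) = runs (rev L)"
  using adj_funpow_step[OF g(2), of T] L(3)
  by (simp only: step_cycle g(3) slow_cycle runs_rev if_True)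

text \<open>The word read from the adjoint of \<open>g\<close> is \<open>runs (rev L)\<close>. If the adjoint is on the cycle, it is so at a change from
\<open>False\<close> to \<open>True\<close>, that is after an even number \<open>j\<close> of runs, where \<open>runs (rotate j L)\<close> is read. Conversely, equal words
determine equal roots.\<close>

lemma adj_iff: "qf_adj g \<in> qf_class f \<longleftrightarrow> (\<exists>j. even j \<and> rev L = rotate j L)"
proof
  have adj: "qf_adj g \<in> H0_forms D" using g(2) by (simp only: H0_adj)
  {
    assume "qf_adj g \<in> qf_class f"
    then obtain i where i: "qf_adj g = (step ^^ i) g" using class_cycle adj by blast
    \<comment> \<open>One additional turn is made so that a preceding step exists even if \<open>i = 0\<close>.\<close>
    define u where "u = T - 1 + i"
    have "Suc u = i + T" using T_pos by (simp add: u_def)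
    then have Suc_u: "(step ^^ Suc u) g = qf_adj g"
      by (simp only: funpow_add comp_apply step_cycle i)
    have "step ((step ^^ (T - 1)) g) = g"
      using step_cycle T_pos by (cases T) auto
    then have 1: "xi_plus (qf_adj g) > 1"
      using adj_step(2)[OF H0_cycle(1), of "T - 1"] last_letter xi_cycle[of "T - 1"] by simp
    have "step ((step ^^ u) g) = qf_adj g" using Suc_u by simp
    then have 2: "\<not> (slow ^^ u) y > 1"
      using adj_step(2)[OF H0_cycle(1), of u] y(2) xi_cycle[of u] g(3) by simp
    have 3: "(slow ^^ Suc u) y = xi_plus (qf_adj g)"
      using xi_cycle[of "Suc u"] Suc_u by metis
    obtain j where j: "even j" "xi_plus (qf_adj g) = (gauss ^^ j) y"
      using slow_turn[OF y(1,2), of u] 1 2 unfolding 3 by metis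
    have "runs (rev L) = runs (rotate j L)"
      using itin_adj itin_rotate[of j] unfolding j(2) by simp
    then have "rev L = rotate j L"
      using L(2) by (intro runs_inject) auto
    then show "\<exists>j. even j \<and> rev L = rotate j L" using j(1) by blast
  }
  {
    assume "\<exists>j. even j \<and> rev L = rotate j L"
    then obtain j where j: "even j" "rev L = rotate j L" by blast
    obtain u where u: "(slow ^^ u) y = (gauss ^^ j) y" using slow_gauss_even[OF j(1)] by blast
    let ?x = "xi_plus (qf_adj g)" and ?z = "(slow ^^ u) y"
    have x: "?x \<in> pos_irrat" using H0_xi(1)[OF adj] .
    have z: "?z \<in> pos_irrat" using y(1) by (rule pos_irrat_funpow_slow)
    have it: "itin T ?x = itin T ?z"
      unfolding itin_adj j(2) u itin_rotate ..
    have perz: "(slow ^^ T) ?z = ?z"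
      by (metis add.commute comp_apply funpow_add slow_cycle(1))
    have "(step ^^ T) (qf_adj g) = qf_adj g"
      using adj_funpow_step[OF g(2), of T] by (simp only: step_cycle)
    then have perx: "(slow ^^ T) ?x = ?x"
      using H0_funpow_step[OF adj, of T] by simp
    have "((slow ^^ i) ?x > 1) = ((slow ^^ i) ?z > 1)" for i
    proof -
      have "((slow ^^ (i mod T)) ?x > 1) = ((slow ^^ (i mod T)) ?z > 1)"
        using it nth_itin[of "i mod T" T] T_pos by (metis mod_less_divisor)
      then show ?thesis
        using funpow_mod_eq[where f = slow and m = i, OF perx]
          funpow_mod_eq[where f = slow and m = i, OF perz] by simp
    qed
    from itinerary_determines[OF x z this, of T 0] perx perz T_pos
    have "?x = ?z" by simp
    then have "qf_adj g = (step ^^ u) g" using adj by (intro cycle_eqI)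
    then show "qf_adj g \<in> qf_class f" using H0_cycle by metis
  }
qed

end

section \<open>Counting along the cycle\<close>

context nonsquare_disc
begin

text \<open>The period of \<open>\<bar>\<xi>\<bar>\<close> may begin at the wrong letter for the cycle of the class; starting one place later
corrects this.\<close>

lemma aligned_period:
  assumes disc: "qf_disc f = D" and per: "is_period f \<Gamma>"
  obtains y l where "l = \<Gamma> \<or> l = rotate1 \<Gamma>" "class_period D f y l"
proof -
  define x where "x = \<bar>xi_plus f\<bar>"
  have irr: "xi_plus f \<notin> \<rat>" by (rule xi_irrat[OF disc])
  have nz: "xi_plus f \<noteq> 0" using irr by (metis Rats_0)
  have x: "x \<in> pos_irrat"
    using irr nz by (auto simp: x_def pos_irrat_def abs_if simp del: xi_plus.simps)
  have \<Gamma>: "\<Gamma> \<noteq> []" "0 \<notin> set \<Gamma>" and min: "\<And>l'. cf_repeats x l' \<Longrightarrow> length \<Gamma> \<le> length l'"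
    using per unfolding is_period_def cf_repeats_def x_def by blast+
  obtain N where N: "\<And>i. cf_quot x (N + i) = int (\<Gamma> ! (i mod length \<Gamma>))"
    using per unfolding is_period_def cf_repeats_def x_def by blast
  \<comment> \<open>The tail after an even number of quotients belongs to \<open>x\<close>, after an odd number to \<open>1 / x\<close>. The root is \<open>x\<close> if
  positive; otherwise it is \<open>- x\<close>, which shares its tail with \<open>1 / x\<close>.\<close>
  define s :: nat where "s = (if (xi_plus f > 0) = even N then 0 else 1)"
  define l where "l = rotate s \<Gamma>"
  define y where "y = (gauss ^^ (N + s)) x"
  have yx: "cf_quot y i = cf_quot x (N + s + i)" for i
    by (simp add: y_def cf_quot_gauss add.commute[of "N + s"] funpow_add)
  have cf: "cf_quot y i = int (l ! (i mod length l))" for i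
  proof -
    have "cf_quot y i = int (\<Gamma> ! ((s + i) mod length \<Gamma>))"
      using N[of "s + i"] by (simp add: yx add.assoc)
    then show ?thesis using \<Gamma> by (simp add: l_def nth_rotate mod_add_right_eq)
  qed
  have y: "y \<in> pos_irrat" unfolding y_def by (rule pos_irrat_funpow_gauss[OF x])
  have l: "l \<noteq> []" "0 \<notin> set l" "length l = length \<Gamma>" using \<Gamma> by (auto simp: l_def)
  have "l ! 0 \<noteq> 0" using l(1,2) by (metis length_greater_0_conv nth_mem)
  then have "\<lfloor>y\<rfloor> \<ge> 1" using cf[of 0] by (simp add: cf_quot_gauss)
  then have y1: "y > 1" using pos_irrat_neq_1[OF y] by linarith
  have merge: "merge y (xi_plus f)"
  proof (cases "xi_plus f > 0")
    case True
    then have "even (N + s)" "x = xi_plus f" by (auto simp: s_def x_def simp del: xi_plus.simps)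
    then show ?thesis using merge_funpow_gauss[OF x, of "N + s"] by (simp add: y_def)
  next
    case False
    then have "odd (N + s)" "1 / x = - 1 / xi_plus f"
      using nz by (auto simp: s_def x_def simp del: xi_plus.simps)
    then have "merge y (- 1 / xi_plus f)"
      using merge_funpow_gauss[OF x, of "N + s"] by (simp add: y_def)
    then show ?thesis using merge_neg_inverse[OF irr] merge_trans by blast
  qed
  have minimal: "length l \<le> j" if j: "j > 0" "(gauss ^^ j) y = y" for j
  proof -
    define l' where "l' = map (\<lambda>i. nat (cf_quot y i)) [0..<j]"
    have pos: "cf_quot y i > 0" for i
      using funpow_gauss_gt_1[OF y y1, of i] by (simp add: cf_quot_gauss)
    have "cf_quot x (N + s + i) = int (l' ! (i mod length l'))" for i
    proof -
      have "cf_quot y i = cf_quot y (i mod j)"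
        using funpow_mod_eq[where f = gauss and m = i, OF j(2)] by (simp add: cf_quot_gauss)
      then show ?thesis using j(1) pos[of "i mod j"] by (simp add: yx[symmetric] l'_def)
    qed
    moreover have "l' \<noteq> []" "0 \<notin> set l'" using j(1) pos by (auto simp: l'_def) (metis not_le)
    ultimately have "cf_repeats x l'" unfolding cf_repeats_def by blast
    from min[OF this] show ?thesis by (simp add: l l'_def)
  qed
  have "l = \<Gamma> \<or> l = rotate1 \<Gamma>" by (auto simp: l_def s_def)
  moreover have "class_period D f y l"
    using disc y y1 merge l cf minimal by unfold_locales auto
  ultimately show thesis using that by blast
qed

end

context class_period
begin

text \<open>At these points the step is made with \<open>opB\<close>.\<close>

lemma card_B: "card {h \<in> qf_class f. h \<in> H0_forms D \<and> qf_eval h 1 1 > 0} = count_list (runs (even_period l)) False"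
proof -
  have "{h \<in> qf_class f. h \<in> H0_forms D \<and> qf_eval h 1 1 > 0} =
    {h \<in> qf_class f. h \<in> H0_forms D \<and> (xi_plus h > 1) = False}"
    using H0_xi(2) by blast
  then show ?thesis by (simp only: card_letter)
qed

lemma card_A: "card {h \<in> qf_class f. h \<in> H0_forms D \<and> \<not> qf_eval h 1 1 > 0} = count_list (runs (even_period l)) True"
proof -
  have "{h \<in> qf_class f. h \<in> H0_forms D \<and> \<not> qf_eval h 1 1 > 0} =
    {h \<in> qf_class f. h \<in> H0_forms D \<and> (xi_plus h > 1) = True}"
    using H0_xi(2) by blast
  then show ?thesis by (simp only: card_letter)
qed

lemma card_GA:
  assumes "H \<in> doms_GA D \<union> doms_GAbar D"
  shows "card (points_in (qf_class f) H) = count_list (runs (even_period l)) False"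
  using assms card_points_HA[OF disc] card_points_HAbar[OF disc]
  by (auto simp: doms_GA_def doms_GAbar_def card_points_T_plus card_points_T_minus card_B
      simp del: qf_eval.simps)

lemma card_GB:
  assumes "H \<in> doms_GB D \<union> doms_GBbar D"
  shows "card (points_in (qf_class f) H) = count_list (runs (even_period l)) True"
  using assms card_points_HB[OF disc] card_points_HBbar[OF disc]
  by (auto simp: doms_GB_def doms_GBbar_def card_points_T_plus card_points_T_minus card_A
      simp del: qf_eval.simps)

lemma symmetric_iff:
  "supersymmetric (qf_class f) \<or> antisymmetric (qf_class f) \<or> mn_symmetric (qf_class f) \<longleftrightarrow>
    odd (length l) \<or> even (length l) \<and> palindromic l"
  unfolding symmetry_types_iff adj_invariant_iff[OF g(1)] anti_invariant_iff[OF g(1)]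
    adj_iff anti_iff palindromic_iff
  by (auto simp: even_period_def)

end

theorem theorem3p12:
  fixes m n k :: int and \<Gamma> \<Pi> :: "nat list" and C :: "int bqf set"
    and \<Delta> :: real and t t_odd t_even :: nat
  assumes "k^2 - 4 * m * n > 0"
    and "\<not> is_square (k^2 - 4 * m * n)"
    and "is_period (m, n, k) \<Gamma>"
    and "\<Pi> = even_period \<Gamma>"
    and "t_odd = (\<Sum>i | i \<in> {1..length \<Pi>} \<and> odd i. \<Pi> ! (i - 1))"
    and "t_even = (\<Sum>i | i \<in> {1..length \<Pi>} \<and> even i. \<Pi> ! (i - 1))"
    and "t = (\<Sum>i\<in>{1..length \<Pi>}. \<Pi> ! (i - 1))"
    and "C = qf_class (m, n, k)"
    and "\<Delta> = real_of_int (k^2 - 4 * m * n)"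
  shows "card (points_in C (dom_H0 \<Delta>)) = t \<and>
    card (points_in C (dom_H0R \<Delta>)) = t \<and>
    ((\<forall>H \<in> doms_GA \<Delta> \<union> doms_GAbar \<Delta>. card (points_in C H) = t_odd) \<and>
     (\<forall>H \<in> doms_GB \<Delta> \<union> doms_GBbar \<Delta>. card (points_in C H) = t_even) \<or>
     (\<forall>H \<in> doms_GA \<Delta> \<union> doms_GAbar \<Delta>. card (points_in C H) = t_even) \<and>
     (\<forall>H \<in> doms_GB \<Delta> \<union> doms_GBbar \<Delta>. card (points_in C H) = t_odd)) \<and>
    (odd (length \<Gamma>) \<or> even (length \<Gamma>) \<and> palindromic \<Gamma> \<longrightarrow>
       real t_odd = real t / 2 \<and> real t_even = real t / 2) \<and>
    (odd (length \<Gamma>) \<or> even (length \<Gamma>) \<and> palindromic \<Gamma> \<longleftrightarrow>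
       supersymmetric C \<or> antisymmetric C \<or> mn_symmetric C)"
proof -
  define D where "D = k^2 - 4 * m * n"
  have D: "qf_disc (m, n, k) = D" "\<Delta> = real_of_int D" using assms(9) by (simp_all add: D_def)
  interpret nonsquare_disc D
    using assms(1,2) by unfold_locales (simp_all add: D_def)
  obtain y l where rot: "l = \<Gamma> \<or> l = rotate1 \<Gamma>" and cp: "class_period D (m, n, k) y l"
    using aligned_period[OF D(1) assms(3)] by blast
  interpret class_period D "(m, n, k)" y l by (rule cp)
  have counts: "count_list (runs \<Pi>) True = t_odd" "count_list (runs \<Pi>) False = t_even"
    using assms(5,6) by (simp_all only: count_runs_True count_runs_False)
  have t: "t = t_odd + t_even" "t = sum_list \<Pi>"
    using count_runs_total[of \<Pi>] assms(7) sum_list_1_based[of \<Pi>] counts by simp_all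
  have ne: "\<Gamma> \<noteq> []" using assms(3) by (simp add: is_period_def cf_repeats_def)
  have same: "length l = length \<Gamma>" "palindromic l = palindromic \<Gamma>"
    using rot by (auto simp: palindromic_rotate1)
  have total: "sum_list (even_period l) = t"
  proof -
    have "sum_list (rotate1 \<Gamma>) = sum_list \<Gamma>" by (cases \<Gamma>) auto
    then show ?thesis using rot t(2) assms(4) by (auto simp: even_period_def)
  qed
  have "card (points_in C (dom_H0 \<Delta>)) = t" "card (points_in C (dom_H0R \<Delta>)) = t"
    using card_H0 by (simp_all only: assms(8) D points_H0[OF D(1)] card_points_H0R[OF D(1)] total)
  moreover have "(\<forall>H \<in> doms_GA \<Delta> \<union> doms_GAbar \<Delta>. card (points_in C H) = t_odd) \<and>
     (\<forall>H \<in> doms_GB \<Delta> \<union> doms_GBbar \<Delta>. card (points_in C H) = t_even) \<or>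
     (\<forall>H \<in> doms_GA \<Delta> \<union> doms_GAbar \<Delta>. card (points_in C H) = t_even) \<and>
     (\<forall>H \<in> doms_GB \<Delta> \<union> doms_GBbar \<Delta>. card (points_in C H) = t_odd)"
    using rot
  proof
    assume "l = \<Gamma>"
    then have "count_list (runs (even_period l)) False = t_even"
      "count_list (runs (even_period l)) True = t_odd"
      using counts assms(4) by simp_all
    then show ?thesis using card_GA card_GB unfolding assms(8) D(2) by metis
  next
    assume "l = rotate1 \<Gamma>"
    then have "count_list (runs (even_period l)) False = t_odd"
      "count_list (runs (even_period l)) True = t_even"
      using counts assms(4) count_runs_even_period_rotate1[OF ne] by simp_all
    then show ?thesis using card_GA card_GB unfolding assms(8) D(2) by metis
  qed
  moreover have "t_odd = t_even" if "odd (length \<Gamma>) \<or> even (length \<Gamma>) \<and> palindromic \<Gamma>"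
    using that
  proof
    assume "odd (length \<Gamma>)"
    then show ?thesis
      using counts count_runs_doubled[of \<Gamma>] assms(4) by (simp add: even_period_def)
  next
    assume "even (length \<Gamma>) \<and> palindromic \<Gamma>"
    then show ?thesis
      using counts count_runs_palindromic[of \<Gamma>] assms(4) by (simp add: even_period_def)
  qed
  then have "odd (length \<Gamma>) \<or> even (length \<Gamma>) \<and> palindromic \<Gamma> \<longrightarrow>
       real t_odd = real t / 2 \<and> real t_even = real t / 2"
    using t(1) by auto
  moreover have "odd (length \<Gamma>) \<or> even (length \<Gamma>) \<and> palindromic \<Gamma> \<longleftrightarrow>
       supersymmetric C \<or> antisymmetric C \<or> mn_symmetric C"
    unfolding assms(8) symmetric_iff same ..
  ultimately show ?thesis by blast
qed

end
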